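(* Let $\xi$ be a $\mathbb{Z}_{\geq 0}$-valued random variable with $\mathbb{E}[\xi] = 1$ and $0 < \mathrm{Var}[\xi] < \infty$, let $\mathcal{T}$ be a Galton-Watson tree with offspring distribution $\xi$, and let $T_n$ be $\mathcal{T}$ conditioned to have $n$ vertices. Let $\epsilon = \epsilon(n) \to 0$ as $n \to \infty$, and let $k = \lfloor (n/\epsilon)^{1/3} \rfloor$. Then, with probability $1 - O(\epsilon)$, $$\min_{j \in \{0, 1, \dots, k-1\}} |\mathcal{C}_k^j(T_n)| \le 2k - 1.$$
   Context: $T_n$ is rooted at the root $r$ of the Galton-Watson tree. For $i \in \mathbb{N}_0$, $\ell_i(T_n)$ is the set of vertices at distance $i$ from $r$. For a vertex $v$, $(T_n)_v$ denotes the full subtree rooted at $v$ (all descendants of $v$, including $v$), and $h((T_n)_v)$ its height (maximum distance from $v$ to a vertex in it). For $k \in \mathbb{N}$ and $j \in \{0,\dots,k-1\}$, $\mathcal{C}_k^j(T_n) = \bigcup_{i=0}^\infty \{v \in \ell_{ik+j}(T_n) : h((T_n)_v) \ge k\}$. The values of $n$ considered are those with $\Pr(|\mathcal{T}| = n) > 0$. *)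

theory Defs
  imports "HOL-Probability.Probability" "HOL-Library.Landau_Symbols" "HOL-Library.Sublist"
begin

text \<open>
  Rooted trees are represented in Ulam--Harris notation: a vertex is the list of child indices
  leading to it from the root \<^term>\<open>[] :: nat list\<close>. The distance of a vertex from the root is thus
  its length, and the descendants of a vertex are its extensions.
\<close>

inductive_set offspring_tree :: "(nat list \<Rightarrow> nat) \<Rightarrow> nat list set"
  for c :: "nat list \<Rightarrow> nat" where
  root: "[] \<in> offspring_tree c"
| child: "v \<in> offspring_tree c \<Longrightarrow> i < c v \<Longrightarrow> v @ [i] \<in> offspring_tree c"

text \<open>
  The Galton--Watson tree driven by a family of offspring counts \<open>X v\<close>, one for every potential
  vertex \<open>v\<close>. It may be infinite.
\<close>

definition gw_tree :: "(nat list \<Rightarrow> 'w \<Rightarrow> nat) \<Rightarrow> 'w \<Rightarrow> nat list set" where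
  "gw_tree X \<omega> = offspring_tree (\<lambda>v. X v \<omega>)"

definition has_size :: "nat list set \<Rightarrow> nat \<Rightarrow> bool" where
  "has_size T n \<longleftrightarrow> finite T \<and> card T = n"

definition level :: "nat list set \<Rightarrow> nat \<Rightarrow> nat list set" where
  "level T i = {v \<in> T. length v = i}"

definition subtree_at :: "nat list set \<Rightarrow> nat list \<Rightarrow> nat list set" where
  "subtree_at T v = {w \<in> T. prefix v w}"

text \<open>Only meaningful for finite \<open>T\<close> and \<open>v \<in> T\<close>.\<close>

definition subtree_height :: "nat list set \<Rightarrow> nat list \<Rightarrow> nat" where
  "subtree_height T v = Max ((\<lambda>w. length w - length v) ` subtree_at T v)"

definition C_set :: "nat \<Rightarrow> nat \<Rightarrow> nat list set \<Rightarrow> nat list set" where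
  "C_set k j T = (\<Union>i. {v \<in> level T (i * k + j). subtree_height T v \<ge> k})"

end

theory Submission
  imports Defs "HOL-Computational_Algebra.Formal_Power_Series"
begin

text \<open>
  If all \<open>k\<close> residue classes contain at least \<open>2 k\<close> vertices, the tree has at least \<open>2 k\<^sup>2\<close> vertices
  whose subtree has height at least \<open>k\<close>; call their number \<open>N\<close>. This is impossible if \<open>k\<^sup>2 > n\<close>.
  Otherwise Markov's inequality reduces the claim to \<open>E[N | size n] = O(n / k)\<close>, because
  \<open>n / k\<^sup>3\<close> is of order \<open>\<epsilon>\<close>.

  Let \<open>F\<close> be the offspring generating function and \<open>A = X F(A)\<close>, \<open>H\<close>, \<open>B\<close> the generating functions
  of all trees, of the trees of height at least \<open>k\<close>, and of all trees weighted by \<open>N\<close>. Differentiating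
  the first equation and splitting \<open>N\<close> at the root give \<open>B F(A) = H A'\<close>, so the coefficients of \<open>B\<close>
  are bounded by those of \<open>H A' / F(0)\<close>. Here Kolmogorov's estimate bounds the total mass of \<open>H\<close> by
  \<open>O(1 / k)\<close>, while by the Otter--Dwass formula \<open>n A\<^sub>n\<close> is the coefficient of \<open>X\<^bsup>n-1\<^esup>\<close> in \<open>F\<^sup>n\<close>.
  That coefficient is of exact order \<open>1 / sqrt n\<close> whenever it is nonzero. To see this without Fourier
  analysis, write \<open>F\<close> as a mixture \<open>\<theta> (1 + X\<^sup>g) / 2 + (1 - \<theta>) R\<close>: the fair coins contribute a binomial
  coefficient, for which explicit bounds are available, and Chebyshev's inequality controls the rest.
\<close>

unbundle no vec_syntax
unbundle fps_syntax

section \<open>Powers of power series with nonnegative coefficients\<close>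

lemma fps_compose_mult_nth:
  fixes f a b :: "real fps"
  assumes "a $ 0 = 0"
  shows "((f oo a) * b) $ n = (\<Sum>i=0..n. f $ i * (a ^ i * b) $ n)"
proof -
  \<comment> \<open>As \<open>a ^ i\<close> has no coefficients below degree \<open>i\<close>, the
    inner sum may run up to \<open>n\<close> for every \<open>m\<close>, which allows exchanging the
    sums.\<close>
  have "((f oo a) * b) $ n = (\<Sum>m=0..n. (\<Sum>i=0..n. f $ i * (a ^ i) $ m) * b $ (n - m))"
    unfolding fps_mult_nth fps_compose_nth using assms
    by (intro sum.cong refl arg_cong2[of _ _ _ _ "(*)"] sum.mono_neutral_left)
       (auto simp: startsby_zero_power_prefix)
  also have "\<dots> = (\<Sum>i=0..n. \<Sum>m=0..n. f $ i * (a ^ i) $ m * b $ (n - m))"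
    unfolding sum_distrib_right by (rule sum.swap)
  also have "\<dots> = (\<Sum>i=0..n. f $ i * (a ^ i * b) $ n)"
    by (simp add: fps_mult_nth sum_distrib_left mult.assoc)
  finally show ?thesis .
qed

lemma power_nth_zero:
  fixes a :: "real fps"
  assumes "a $ 0 = 0" "n < m"
  shows "(a ^ m) $ n = 0"
  using startsby_zero_power_prefix[of a m] assms by auto

text \<open>Lagrange inversion, by induction on \<open>n\<close> for all powers \<open>r\<close> at
  once: one factor A = X F(A) is expanded, the induction hypothesis is applied to every resulting
  power of A, and the weights i F_i that appear are absorbed by the derivative of a power of
  F.\<close>

lemma otter_dwass:
  fixes A F :: "real fps"
  assumes A: "A = fps_X * (F oo A)" and "1 \<le> r" "r \<le> n"
  shows "real n * (A ^ r) $ n = real r * (F ^ n) $ (n - r)"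
  using assms(2,3)
proof (induction n arbitrary: r)
  case (Suc m)
  have A0: "A $ 0 = 0" by (subst A) simp
  obtain r' where r: "r = Suc r'" using Suc.prems by (cases r) auto
  have r'm: "r' \<le> m" using Suc.prems r by simp
  have "A ^ r = fps_X * ((F oo A) * A ^ r')"
    unfolding r by (subst power_Suc, subst (1) A) (simp add: mult.assoc)
  then have "(A ^ r) $ Suc m = ((F oo A) * A ^ r') $ m" by simp
  also have "\<dots> = (\<Sum>i=0..m. F $ i * (A ^ (i + r')) $ m)"
    by (simp add: fps_compose_mult_nth[OF A0] power_add)
  also have "\<dots> = (\<Sum>i=0..m - r'. F $ i * (A ^ (i + r')) $ m)"
    by (rule sum.mono_neutral_right) (use r'm in \<open>auto simp: power_nth_zero[OF A0]\<close>)
  finally have Ar: "(A ^ r) $ Suc m = (\<Sum>i=0..m - r'. F $ i * (A ^ (i + r')) $ m)" .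
  show ?case
  \<comment> \<open>The induction hypothesis carries a factor \<open>m\<close> that is cancelled at
    the end, so \<open>m = 0\<close> is separate.\<close>
  proof (cases "m = 0")
    case True
    then show ?thesis using Ar r r'm by simp
  next
    case False
    have IH: "real m * (A ^ (i + r')) $ m = real (i + r') * (F ^ m) $ (m - r' - i)" if "i \<le> m - r'" for i
    proof (cases "i + r' = 0")
      case False
      then have "1 \<le> i + r'" by linarith
      moreover have "i + r' \<le> m" and "m - (i + r') = m - r' - i" using that r'm by auto
      ultimately show ?thesis using Suc.IH[of "i + r'"] by simp
    qed (use \<open>m \<noteq> 0\<close> in simp)
    define T where "T = (fps_X * fps_deriv F * F ^ m) $ (m - r')"
    have "real m * (A ^ r) $ Suc m = (\<Sum>i=0..m - r'. F $ i * (real (i + r') * (F ^ m) $ (m - r' - i)))"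
      unfolding Ar sum_distrib_left
      by (rule sum.cong[OF refl]) (subst mult.left_commute, simp add: IH)
    also have "\<dots> = real r' * (\<Sum>i=0..m - r'. F $ i * (F ^ m) $ (m - r' - i))
        + (\<Sum>i=0..m - r'. (fps_X * fps_deriv F) $ i * (F ^ m) $ (m - r' - i))"
    proof -
      have X: "(fps_X * fps_deriv F) $ i = real i * F $ i" for i by (cases i) auto
      show ?thesis unfolding X by (simp add: sum_distrib_left sum.distrib[symmetric] algebra_simps)
    qed
    also have "\<dots> = real r' * (F ^ Suc m) $ (m - r') + T"
      by (simp add: T_def fps_mult_nth)
    finally have 1: "real m * (A ^ r) $ Suc m = real r' * (F ^ Suc m) $ (m - r') + T" .
    \<comment> \<open>\<open>T\<close> is evaluated by reading X (F^(m+1))' in two ways: by the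
      chain rule, and as multiplication of each coefficient by its index.\<close>
    have "fps_X * fps_deriv (F ^ Suc m) = of_nat (Suc m) * (fps_X * fps_deriv F * F ^ m)"
      by (subst fps_deriv_power) (simp add: fps_of_nat mult_ac del: of_nat_Suc power_Suc)
    then have "(fps_X * fps_deriv (F ^ Suc m)) $ (m - r') = real (Suc m) * T"
      by (simp only: T_def fps_mult_of_nat_nth)
    moreover have "(fps_X * fps_deriv (F ^ Suc m)) $ (m - r') = real (m - r') * (F ^ Suc m) $ (m - r')"
      by (cases "m - r'") (auto simp del: power_Suc)
    ultimately have 2: "real (Suc m) * T = real (m - r') * (F ^ Suc m) $ (m - r')" by simp
    have "real m * (real (Suc m) * (A ^ r) $ Suc m)
        = real (Suc m) * real r' * (F ^ Suc m) $ (m - r') + real (m - r') * (F ^ Suc m) $ (m - r')"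
      using 1 2 by (metis (no_types, opaque_lifting) distrib_left mult.assoc mult.left_commute)
    also have "\<dots> = real m * (real r * (F ^ Suc m) $ (m - r'))"
      using r'm by (simp add: r of_nat_diff algebra_simps)
    finally show ?thesis using False r by simp
  qed
qed simp

section \<open>Moments and concentration for probability generating functions\<close>

definition has_moments :: "real fps \<Rightarrow> real \<Rightarrow> real \<Rightarrow> bool" where
  "has_moments G m s \<longleftrightarrow> (\<forall>i. G $ i \<ge> 0) \<and> (\<lambda>i. G $ i) sums 1 \<and>
     (\<lambda>i. real i * G $ i) sums m \<and> (\<lambda>i. (real i)\<^sup>2 * G $ i) sums s"

lemma Cauchy_product_sums_nonneg:
  fixes a b :: "nat \<Rightarrow> real"
  assumes "a sums x" "b sums y" "\<And>i. a i \<ge> 0" "\<And>i. b i \<ge> 0"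
  shows "(\<lambda>k. \<Sum>i\<le>k. a i * b (k - i)) sums (x * y)"
  using Cauchy_product_sums[of a b] assms by (simp add: sums_iff)

text \<open>The product is the law of a sum of independent variables: k = i + (k - i) and its square
  are expanded inside the Cauchy product.\<close>

lemma has_moments_mult:
  assumes "has_moments G m s" "has_moments H m' s'"
  shows "has_moments (G * H) (m + m') (s + 2 * m * m' + s')"
proof -
  have G: "G $ i \<ge> 0" "(\<lambda>i. G $ i) sums 1" "(\<lambda>i. real i * G $ i) sums m" "(\<lambda>i. (real i)\<^sup>2 * G $ i) sums s"
    and H: "H $ i \<ge> 0" "(\<lambda>i. H $ i) sums 1" "(\<lambda>i. real i * H $ i) sums m'" "(\<lambda>i. (real i)\<^sup>2 * H $ i) sums s'" for i
    using assms by (auto simp: has_moments_def)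
  note C = Cauchy_product_sums_nonneg
  have 0: "(\<lambda>k. (G * H) $ k) sums 1"
    using C[OF G(2) H(2) G(1) H(1)] by (simp add: fps_mult_nth atLeast0AtMost)
  have "(\<lambda>k. (\<Sum>i\<le>k. (real i * G $ i) * H $ (k - i)) + (\<Sum>i\<le>k. G $ i * (real (k - i) * H $ (k - i))))
      sums (m * 1 + 1 * m')"
    by (intro sums_add C G H) (simp_all add: G H)
  moreover have "(\<Sum>i\<le>k. (real i * G $ i) * H $ (k - i)) + (\<Sum>i\<le>k. G $ i * (real (k - i) * H $ (k - i)))
      = real k * (G * H) $ k" for k
    unfolding fps_mult_nth atLeast0AtMost sum.distrib[symmetric] sum_distrib_left
    by (rule sum.cong[OF refl]) (simp add: of_nat_diff algebra_simps)
  ultimately have 1: "(\<lambda>k. real k * (G * H) $ k) sums (m + m')" by simp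
  have "(\<lambda>k. (\<Sum>i\<le>k. ((real i)\<^sup>2 * G $ i) * H $ (k - i))
        + 2 * (\<Sum>i\<le>k. (real i * G $ i) * (real (k - i) * H $ (k - i)))
        + (\<Sum>i\<le>k. G $ i * ((real (k - i))\<^sup>2 * H $ (k - i))))
      sums (s * 1 + 2 * (m * m') + 1 * s')"
    by (intro sums_add sums_mult C G H) (simp_all add: G H)
  moreover have "(\<Sum>i\<le>k. ((real i)\<^sup>2 * G $ i) * H $ (k - i))
        + 2 * (\<Sum>i\<le>k. (real i * G $ i) * (real (k - i) * H $ (k - i)))
        + (\<Sum>i\<le>k. G $ i * ((real (k - i))\<^sup>2 * H $ (k - i))) = (real k)\<^sup>2 * (G * H) $ k" for k
    unfolding fps_mult_nth atLeast0AtMost sum.distrib[symmetric] sum_distrib_left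
    by (rule sum.cong[OF refl]) (simp add: of_nat_diff algebra_simps power2_eq_square)
  ultimately have 2: "(\<lambda>k. (real k)\<^sup>2 * (G * H) $ k) sums (s + 2 * m * m' + s')"
    by (simp add: mult.assoc)
  have "(G * H) $ i \<ge> 0" for i
    unfolding fps_mult_nth by (intro sum_nonneg mult_nonneg_nonneg G H)
  with 0 1 2 show ?thesis by (simp add: has_moments_def)
qed

lemma has_moments_1: "has_moments 1 0 0"
proof -
  have "(\<lambda>i. f i * (1 :: real fps) $ i) sums f 0" for f :: "nat \<Rightarrow> real"
    using sums_single[of 0 f] by (rule sums_cong[THEN iffD1, rotated]) auto
  from this[of "\<lambda>_. 1"] this[of real] this[of "\<lambda>i. (real i)\<^sup>2"] show ?thesis
    by (simp add: has_moments_def)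
qed

text \<open>The second moment is written as variance plus squared mean, so that Chebyshev's
  inequality sees only \<open>n\<close> times the variance s - m^2.\<close>

lemma has_moments_power:
  assumes "has_moments G m s"
  shows "has_moments (G ^ n) (real n * m) (real n * (s - m\<^sup>2) + (real n * m)\<^sup>2)"
proof (induction n)
  case 0
  show ?case using has_moments_1 by simp
next
  case (Suc n)
  show ?case
    using has_moments_mult[OF assms Suc] by (simp add: algebra_simps power2_eq_square)
qed

lemma has_moments_nonneg: "has_moments G m s \<Longrightarrow> G $ i \<ge> 0"
  by (simp add: has_moments_def)

lemma has_moments_sum_le_1:
  assumes "has_moments G m s" "finite I"
  shows "(\<Sum>i\<in>I. G $ i) \<le> 1"
  using sum_le_suminf[of "\<lambda>i. G $ i" I] assms by (simp add: has_moments_def sums_iff)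

lemma has_moments_chebyshev:
  assumes "has_moments G m s" "d > 0"
  shows "finite {j. \<bar>real j - m\<bar> \<le> d}"
    and "(\<Sum>j | \<bar>real j - m\<bar> \<le> d. G $ j) \<ge> 1 - (s - m\<^sup>2) / d\<^sup>2"
proof -
  let ?J = "{j. \<bar>real j - m\<bar> \<le> d}"
  have "?J \<subseteq> {..nat \<lceil>m + d\<rceil>}"
    by (auto simp: le_nat_iff) linarith
  then show fin: "finite ?J" by (rule finite_subset) simp
  have G: "G $ i \<ge> 0" "(\<lambda>i. G $ i) sums 1" "(\<lambda>i. real i * G $ i) sums m" "(\<lambda>i. (real i)\<^sup>2 * G $ i) sums s" for i
    using assms by (auto simp: has_moments_def)
  \<comment> \<open>Chebyshev's inequality by summing a pointwise bound: d^2 is at most (i - m)^2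
    plus d^2 times the indicator of \<open>?J\<close>, weighted with \<open>G $ i\<close>.\<close>
  have 1: "(\<lambda>i. ((real i)\<^sup>2 * G $ i - 2 * m * (real i * G $ i) + m\<^sup>2 * G $ i)
          + d\<^sup>2 * (if i \<in> ?J then G $ i else 0))
      sums ((s - 2 * m * m + m\<^sup>2 * 1) + d\<^sup>2 * (\<Sum>i\<in>?J. G $ i))"
    by (intro sums_add sums_diff sums_mult G sums_If_finite_set fin)
  have 2: "(\<lambda>i. d\<^sup>2 * G $ i) sums (d\<^sup>2 * 1)"
    by (intro sums_mult G)
  have 3: "d\<^sup>2 * G $ i \<le> ((real i)\<^sup>2 * G $ i - 2 * m * (real i * G $ i) + m\<^sup>2 * G $ i)
          + d\<^sup>2 * (if i \<in> ?J then G $ i else 0)" for i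
  proof -
    have eq: "(real i)\<^sup>2 * G $ i - 2 * m * (real i * G $ i) + m\<^sup>2 * G $ i = (real i - m)\<^sup>2 * G $ i"
      by (simp add: algebra_simps power2_eq_square)
    show ?thesis
    proof (cases "i \<in> ?J")
      case False
      then have "d\<^sup>2 \<le> (real i - m)\<^sup>2"
        using assms(2) by (simp add: abs_le_square_iff[symmetric])
      then show ?thesis
        unfolding eq using False G(1)[of i] by (simp add: mult_right_mono)
    qed (simp add: eq G)
  qed
  have "d\<^sup>2 * 1 \<le> (s - 2 * m * m + m\<^sup>2 * 1) + d\<^sup>2 * (\<Sum>i\<in>?J. G $ i)"
    by (rule sums_le[OF 3 2 1])
  then have "d\<^sup>2 - (s - m\<^sup>2) \<le> (\<Sum>i\<in>?J. G $ i) * d\<^sup>2"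
    by (simp add: algebra_simps power2_eq_square)
  then have "(d\<^sup>2 - (s - m\<^sup>2)) / d\<^sup>2 \<le> (\<Sum>i\<in>?J. G $ i)"
    using assms(2) by (simp add: pos_divide_le_eq)
  moreover have "(d\<^sup>2 - (s - m\<^sup>2)) / d\<^sup>2 = 1 - (s - m\<^sup>2) / d\<^sup>2"
    using assms(2) by (simp add: diff_divide_distrib)
  ultimately show "(\<Sum>j\<in>?J. G $ j) \<ge> 1 - (s - m\<^sup>2) / d\<^sup>2"
    by simp
qed

lemma has_moments_concentration:
  assumes "has_moments G m s"
  obtains A where "A > 0" "\<And>n. finite {j. \<bar>real j - real n * m\<bar> \<le> A * sqrt n}"
    "\<And>n. (\<Sum>j | \<bar>real j - real n * m\<bar> \<le> A * sqrt n. (G ^ n) $ j) \<ge> 1 / 2"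
proof
  \<comment> \<open>Twice the variance makes the Chebyshev error at most 1/2; the summand 1 keeps
    \<open>?A\<close> positive for a degenerate law.\<close>
  let ?A = "sqrt (2 * \<bar>s - m\<^sup>2\<bar> + 1)"
  have pos: "2 * \<bar>s - m\<^sup>2\<bar> + 1 > 0" by (intro add_nonneg_pos) auto
  then show A0: "?A > 0" by simp
  fix n :: nat
  have "finite {j. \<bar>real j - real n * m\<bar> \<le> ?A * sqrt n} \<and>
    (\<Sum>j | \<bar>real j - real n * m\<bar> \<le> ?A * sqrt n. (G ^ n) $ j) \<ge> 1 / 2"
  proof (cases "n = 0")
    case True
    then have "{j. \<bar>real j - real n * m\<bar> \<le> ?A * sqrt n} = {0}" by auto
    then show ?thesis using True by simp
  next
    case False
    then have d: "?A * sqrt n > 0" using A0 by simp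
    note C = has_moments_chebyshev[OF has_moments_power[OF assms, of n] d]
    have "(s - m\<^sup>2) / (2 * \<bar>s - m\<^sup>2\<bar> + 1) \<le> 1 / 2"
      using abs_ge_self[of "s - m\<^sup>2"] pos by (subst pos_divide_le_eq) (auto simp: algebra_simps)
    moreover have "1 - (s - m\<^sup>2) / (2 * \<bar>s - m\<^sup>2\<bar> + 1)
        \<le> (\<Sum>j | \<bar>real j - real n * m\<bar> \<le> ?A * sqrt n. (G ^ n) $ j)"
      using C(2) False by (simp add: power_mult_distrib)
    ultimately show ?thesis using C(1) by linarith
  qed
  then show "finite {j. \<bar>real j - real n * m\<bar> \<le> ?A * sqrt n}"
    "(\<Sum>j | \<bar>real j - real n * m\<bar> \<le> ?A * sqrt n. (G ^ n) $ j) \<ge> 1 / 2" by auto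
qed

section \<open>Binomial coefficients near the middle\<close>

text \<open>The normalised coefficients satisfy c_(n+1) = c_n (2n + 1) / (2n + 2). Squared, the two
  inductions come down to (2n + 1)(2n + 3) \<le> (2n + 2)^2 and 4n(n + 1) \<le> (2n + 1)^2, which
  avoids Stirling's formula.\<close>

lemma central_binomial_bounds:
  fixes n :: nat
  shows "(real ((2 * n) choose n) / 4 ^ n)\<^sup>2 \<le> 1 / (2 * n + 1)"
    and "n \<ge> 1 \<Longrightarrow> (real ((2 * n) choose n) / 4 ^ n)\<^sup>2 \<ge> 1 / (4 * n)"
proof -
  define c where "c = (\<lambda>n. real ((2 * n) choose n) / 4 ^ n)"
  have c_Suc: "c (Suc n) = c n * ((2 * n + 1) / (2 * n + 2))" for n
  proof -
    have 1: "Suc n * (Suc (Suc (2 * n)) choose Suc n) = Suc (Suc (2 * n)) * (Suc (2 * n) choose n)"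
      by (rule Suc_times_binomial)
    have 2: "Suc n * (Suc (2 * n) choose n) = Suc (2 * n) * (2 * n choose n)"
      using Suc_times_binomial_eq[of "2 * n" n] binomial_symmetric[of n "Suc (2 * n)"]
        Suc_times_binomial[of n "2 * n"]
      by (simp add: mult_ac)
    have "real (Suc n) * real (Suc n) * real (Suc (Suc (2 * n)) choose Suc n)
        = real (Suc (Suc (2 * n))) * (real (Suc n) * real (Suc (2 * n) choose n))"
      using arg_cong[OF 1, of real] by (simp only: of_nat_mult mult_ac)
    also have "real (Suc n) * real (Suc (2 * n) choose n) = real (Suc (2 * n)) * real (2 * n choose n)"
      using arg_cong[OF 2, of real] by (simp only: of_nat_mult)
    also have "real (Suc (Suc (2 * n))) * (real (Suc (2 * n)) * real (2 * n choose n))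
        = real (Suc n) * real (Suc n) * (real (2 * n choose n) * (4 * ((2 * n + 1) / (2 * n + 2))))"
    proof -
      have gen: "2 * S * (a * C) = S * S * (C * (4 * (a / (2 * S))))" if "S \<noteq> 0" for a S C :: real
        using that by simp
      have "real (2 * n + 2) = 2 * real (Suc n)" "real (Suc (Suc (2 * n))) = 2 * real (Suc n)"
        "real (2 * n + 1) = real (Suc (2 * n))" by simp_all
      then show ?thesis
        using gen[of "real (Suc n)" "real (Suc (2 * n))" "real (2 * n choose n)", OF of_nat_neq_0]
        by (simp only:)
    qed
    finally have "real (Suc n) * real (Suc n) * real (Suc (Suc (2 * n)) choose Suc n)
        = real (Suc n) * real (Suc n) * (real (2 * n choose n) * (4 * ((2 * n + 1) / (2 * n + 2))))" .
    then have "real (Suc (Suc (2 * n)) choose Suc n) = real (2 * n choose n) * (4 * ((2 * n + 1) / (2 * n + 2)))"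
      by (rule iffD1[OF mult_left_cancel, rotated]) simp
    moreover have "2 * Suc n = Suc (Suc (2 * n))" by simp
    moreover have "C * (4 * x) / (4 * y) = C / y * x" for C x y :: real by simp
    moreover have "real (2 * n + 1) / real (2 * n + 2) = (2 * real n + 1) / (2 * real n + 2)"
      by (simp add: add.commute)
    ultimately show ?thesis by (simp only: c_def power_Suc)
  qed
  have ub: "(c n)\<^sup>2 \<le> 1 / (2 * real n + 1)" for n
  proof (induction n)
    case (Suc n)
    have "(c (Suc n))\<^sup>2 = (c n)\<^sup>2 * ((2 * real n + 1) / (2 * real n + 2))\<^sup>2"
      unfolding c_Suc power_mult_distrib by (simp add: add.commute)
    also have "\<dots> \<le> 1 / (2 * real n + 1) * ((2 * real n + 1) / (2 * real n + 2))\<^sup>2"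
      by (intro mult_right_mono Suc.IH) auto
    also have "\<dots> \<le> 1 / (2 * real (Suc n) + 1)"
    proof -
      have "1 / (2 * x + 1) * ((2 * x + 1) / (2 * x + 2))\<^sup>2 \<le> 1 / (2 * (x + 1) + 1)"
        if "x \<ge> 0" for x :: real
      proof -
        have pos: "2 * x + 1 > 0" "2 * x + 2 > 0" "2 * (x + 1) + 1 > 0" using that by auto
        have "1 / (2 * x + 1) * ((2 * x + 1) / (2 * x + 2))\<^sup>2 = (2 * x + 1) / (2 * x + 2)\<^sup>2"
          using pos by (simp add: power_divide) (simp add: power2_eq_square)
        also have "\<dots> \<le> 1 / (2 * (x + 1) + 1)"
          using pos by (simp add: frac_le_eq pos_divide_le_eq pos_le_divide_eq)
            (simp add: algebra_simps power2_eq_square)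
        finally show ?thesis .
      qed
      from this[of "real n"] show ?thesis by (simp add: add.commute)
    qed
    finally show ?case .
  qed (simp add: c_def)
  have lb: "(c n)\<^sup>2 \<ge> 1 / (4 * real n)" if "n \<ge> 1" for n
    using that
  proof (induction n rule: nat_induct_at_least)
    case base
    then show ?case by (simp add: c_def power2_eq_square)
  next
    case (Suc n)
    have "1 / (4 * real (Suc n)) \<le> 1 / (4 * real n) * ((2 * real n + 1) / (2 * real n + 2))\<^sup>2"
    proof -
      have "1 / (4 * (x + 1)) \<le> 1 / (4 * x) * ((2 * x + 1) / (2 * x + 2))\<^sup>2" if "x > 0" for x :: real
      proof -
        have "1 / (4 * (x + 1)) = 4 * x * (x + 1) / (4 * x * (2 * x + 2)\<^sup>2)"
        proof -
          have "(2 * x + 2)\<^sup>2 = 4 * (x + 1) * (x + 1)" by (simp add: power2_eq_square algebra_simps)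
          then show ?thesis using that by simp
        qed
        also have "\<dots> \<le> (2 * x + 1)\<^sup>2 / (4 * x * (2 * x + 2)\<^sup>2)"
          using that by (intro divide_right_mono) (auto simp: power2_eq_square algebra_simps)
        finally show ?thesis by (simp add: power_divide)
      qed
      from this[of "real n"] show ?thesis using Suc.hyps by (simp add: add.commute)
    qed
    also have "\<dots> \<le> (c n)\<^sup>2 * ((2 * real n + 1) / (2 * real n + 2))\<^sup>2"
      by (intro mult_right_mono Suc.IH) auto
    also have "\<dots> = (c (Suc n))\<^sup>2"
      unfolding c_Suc power_mult_distrib by (simp add: add.commute)
    finally show ?case .
  qed
  show "(real ((2 * n) choose n) / 4 ^ n)\<^sup>2 \<le> 1 / (2 * n + 1)"
    using ub[of n] by (simp add: c_def add.commute)
  show "(real ((2 * n) choose n) / 4 ^ n)\<^sup>2 \<ge> 1 / (4 * n)" if "n \<ge> 1"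
    using lb[OF that] by (simp add: c_def)
qed

text \<open>By Pascal's rule and symmetry, the central coefficient of the next row is twice the
  middle one of an odd row.\<close>

lemma middle_binomial_odd:
  "real (Suc (2 * n) choose n) / 2 ^ Suc (2 * n) = real ((2 * Suc n) choose Suc n) / 4 ^ Suc n"
proof -
  have "(2 * Suc n) choose Suc n = (Suc (2 * n) choose n) + (Suc (2 * n) choose Suc n)"
    by simp
  also have "Suc (2 * n) choose Suc n = Suc (2 * n) choose n"
    using binomial_symmetric[of n "Suc (2 * n)"] by simp
  finally have "(2 * Suc n) choose Suc n = 2 * (Suc (2 * n) choose n)" by simp
  moreover have "(2::real) ^ (2 * n) = 4 ^ n" by (simp add: power_mult)
  ultimately show ?thesis by (simp del: binomial_Suc_Suc)
qed

lemma middle_binomial_bounds: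
  fixes N :: nat
  shows "(real (N choose (N div 2)) / 2 ^ N)\<^sup>2 \<le> 1 / (N + 1)"
    and "N \<ge> 1 \<Longrightarrow> (real (N choose (N div 2)) / 2 ^ N)\<^sup>2 \<ge> 1 / (4 * N)"
proof -
  have *: "(real (N choose (N div 2)) / 2 ^ N)\<^sup>2 \<le> 1 / (N + 1) \<and>
      (N \<ge> 1 \<longrightarrow> (real (N choose (N div 2)) / 2 ^ N)\<^sup>2 \<ge> 1 / (4 * N))"
  proof (cases "even N")
    case True
    then obtain n where N: "N = 2 * n" by blast
    have "1 / (4 * real (2 * n)) \<le> 1 / (4 * real n)" if "n \<ge> 1"
      using that by (intro divide_left_mono) auto
    then show ?thesis
      using central_binomial_bounds[of n] by (auto simp: N power_mult)
  next
    case False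
    then obtain n where N: "N = Suc (2 * n)" by (metis oddE Suc_eq_plus1)
    have 1: "1 / real (2 * Suc n + 1) \<le> 1 / real (N + 1)"
      unfolding N by (intro divide_left_mono) auto
    have 2: "1 / real (4 * N) \<le> 1 / real (4 * Suc n)"
      unfolding N by (intro divide_left_mono) auto
    have "N div 2 = n" using N by simp
    then have "real (N choose (N div 2)) / 2 ^ N = real ((2 * Suc n) choose Suc n) / 4 ^ Suc n"
      unfolding N using middle_binomial_odd[of n] by simp
    moreover have "Suc n \<ge> 1" by simp
    ultimately show ?thesis
      using order_trans[OF central_binomial_bounds(1)[of "Suc n"] 1]
        order_trans[OF 2 central_binomial_bounds(2)[of "Suc n"]]
      by (simp only: simp_thms)
  qed
  then show "(real (N choose (N div 2)) / 2 ^ N)\<^sup>2 \<le> 1 / (N + 1)"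
    "N \<ge> 1 \<Longrightarrow> (real (N choose (N div 2)) / 2 ^ N)\<^sup>2 \<ge> 1 / (4 * N)" by auto
qed

lemma binomial_div_power_le: "real (N choose l) / 2 ^ N \<le> 1 / sqrt (N + 1)"
proof -
  have "real (N choose l) / 2 ^ N \<le> real (N choose (N div 2)) / 2 ^ N"
    by (intro divide_right_mono of_nat_mono binomial_maximum) auto
  also have "\<dots> \<le> sqrt (1 / (N + 1))"
    by (rule real_le_rsqrt) (use middle_binomial_bounds(1)[of N] in simp)
  finally show ?thesis by (simp add: real_sqrt_divide)
qed

lemma one_minus_ge_exp:
  fixes x :: real
  assumes "0 \<le> x" "x \<le> 1 / 2"
  shows "exp (- 2 * x) \<le> 1 - x"
proof -
  have "x\<^sup>2 \<le> x * (1 / 2)" unfolding power2_eq_square using assms by (intro mult_left_mono) auto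
  with ln_one_minus_pos_lower_bound[OF assms] have "- 2 * x \<le> ln (1 - x)" by linarith
  then have "exp (- 2 * x) \<le> exp (ln (1 - x))" by simp
  also have "\<dots> = 1 - x" using assms by simp
  finally show ?thesis .
qed

text \<open>A step from l to l + 1 multiplies the coefficient by (N - l) / (l + 1). For l = N/2 +
  O(sqrt N) this ratio is at least 1 - B / sqrt N. The 1 in the bound on \<open>j\<close> pays for
  rounding N/2 down.\<close>

lemma binomial_offset_ge:
  fixes A B :: real
  assumes "A > 0" "B = 4 * A + 6" "sqrt N \<ge> 2 * B" "real j \<le> A * sqrt N + 1"
  shows "real (N choose (N div 2)) * (1 - B / sqrt N) ^ j \<le> real (N choose (N div 2 + j))"
  using assms(4)
proof (induction j)
  case (Suc j)
  let ?l = "N div 2 + j"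
  have "sqrt N \<ge> 12" using assms(1-3) by linarith
  then have N1: "sqrt N \<ge> 1" and N0: "sqrt N > 0" by linarith+
  then have NB: "B / sqrt N \<le> 1 / 2" using assms(3) by (simp only: pos_divide_le_eq)
  have j: "real j \<le> A * sqrt N" using Suc.prems by simp
  \<comment> \<open>The size of \<open>B\<close> serves twice: it keeps \<open>?l\<close> below
    \<open>N\<close>, and it makes 2j + 1 \<le> B sqrt N / 2.\<close>
  have B_sqrt: "(4 * A + 6) * sqrt N = 4 * (A * sqrt N) + 6 * sqrt N"
    by (simp add: algebra_simps)
  have aux: "a + 1 \<le> (4 * a + 6 * r) / 4 \<and> (x \<le> a \<longrightarrow> 2 * x + 1 \<le> (4 * a + 6 * r) / 2)"
    if "1 \<le> r" for a r x :: real
    using that by (simp add: add_divide_distrib)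
  have "A * sqrt N + 1 \<le> (4 * A + 6) * sqrt N / 4"
    unfolding B_sqrt using aux[OF N1] by blast
  also have "\<dots> \<le> sqrt N * sqrt N / 8"
    using assms(2,3) mult_right_mono[of "2 * B" "sqrt N" "sqrt N"] N1 by (simp add: algebra_simps)
  finally have "A * sqrt N + 1 \<le> real N / 8" by simp
  then have "?l \<le> N" using j by linarith
  have ml: "real (?l + 1) * real (N choose (?l + 1)) = real (N - ?l) * real (N choose ?l)"
    using binomial_absorb_comp[of N ?l] binomial_absorption[of ?l N]
    by (metis Suc_eq_plus1 of_nat_mult)
  have l2: "real N / 2 \<le> real (?l + 1)" by linarith
  have "real N = sqrt N * sqrt N" by simp
  then have "B * sqrt N / 2 = real N / 2 * (B / sqrt N)" using N0 by (simp add: field_simps)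
  also have "\<dots> \<le> real (?l + 1) * (B / sqrt N)"
    by (rule mult_right_mono[OF l2]) (use assms in simp)
  finally have 1: "B * sqrt N / 2 \<le> real (?l + 1) * (B / sqrt N)" .
  have "real (2 * ?l) \<le> real (N + 2 * j)" by (rule of_nat_mono) simp
  then have 2: "2 * real ?l + 1 - real N \<le> 2 * real j + 1" by simp
  have 3: "2 * real j + 1 \<le> B * sqrt N / 2"
    unfolding assms(2) B_sqrt using j aux[OF N1] by blast
  have 4: "real (?l + 1) * (1 - B / sqrt N) = real ?l + 1 - real (?l + 1) * (B / sqrt N)"
    by (simp add: right_diff_distrib)
  have "real (?l + 1) * (1 - B / sqrt N) \<le> real N - real ?l"
    unfolding 4 using order_trans[OF 2 order_trans[OF 3 1]] by (simp add: algebra_simps)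
  then have "real (?l + 1) * (1 - B / sqrt N) \<le> real (N - ?l)"
    using \<open>?l \<le> N\<close> by (simp only: of_nat_diff)
  then have "real (?l + 1) * (1 - B / sqrt N) * real (N choose ?l) \<le> real (?l + 1) * real (N choose (?l + 1))"
    unfolding ml by (rule mult_right_mono) simp
  then have step: "(1 - B / sqrt N) * real (N choose ?l) \<le> real (N choose (?l + 1))"
    by (simp only: mult.assoc) (subst (asm) mult_le_cancel_left_pos, auto)
  have "real (N choose (N div 2)) * (1 - B / sqrt N) ^ Suc j
      = (1 - B / sqrt N) * (real (N choose (N div 2)) * (1 - B / sqrt N) ^ j)" by simp
  also have "\<dots> \<le> (1 - B / sqrt N) * real (N choose ?l)"
    using Suc.IH Suc.prems order_trans[OF NB, of 1] by (intro mult_left_mono) auto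
  finally show ?case using step by simp
qed simp

text \<open>At distance j \<le> A sqrt N + 1 from the middle the loss (1 - B / sqrt N)^j stays above
  exp(-2B(A + 1)), and the middle term is at least 1 / (2 sqrt N). Indices left of the middle are
  reflected.\<close>

lemma binomial_div_power_ge:
  fixes A :: real
  assumes "A > 0"
  obtains c N0 where "c > 0"
    "\<And>N l. N \<ge> N0 \<Longrightarrow> \<bar>real l - real N / 2\<bar> \<le> A * sqrt N \<Longrightarrow> real (N choose l) / 2 ^ N \<ge> c / sqrt N"
proof -
  define B where "B = 4 * A + 6"
  define c where "c = exp (- 2 * B * (A + 1)) / 2"
  \<comment> \<open>From this size on B / sqrt N \<le> 1/2, as \<open>one_minus_ge_exp\<close>
    requires.\<close>
  define N0 where "N0 = nat \<lceil>(2 * B)\<^sup>2\<rceil>"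
  have upper: "real (N choose l) / 2 ^ N \<ge> c / sqrt N"
    if N: "N \<ge> N0" and l: "N div 2 \<le> l" "real l - real N / 2 \<le> A * sqrt N" for N l
  proof -
    have "(2 * B)\<^sup>2 \<le> real N" using N unfolding N0_def by linarith
    then have sq: "2 * B \<le> sqrt N" by (rule real_le_rsqrt)
    have B0: "B \<ge> 6" using assms by (simp add: B_def)
    then have N1: "sqrt N \<ge> 1" and N0: "sqrt N > 0" using sq by linarith+
    then have NB: "B / sqrt N \<le> 1 / 2" using sq by (simp only: pos_divide_le_eq)
    define j where "j = l - N div 2"
    have lj: "l = N div 2 + j" using l j_def by simp
    have "real N / 2 \<le> real (N div 2) + 1" by linarith
    then have j: "real j \<le> A * sqrt N + 1" using l lj by linarith
    also have "\<dots> \<le> (A + 1) * sqrt N" using N1 by (simp add: algebra_simps)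
    finally have j': "real j / sqrt N \<le> A + 1" using N0 by (simp add: field_simps)
    have "2 * c = exp (- 2 * B * (A + 1))" by (simp add: c_def)
    also have "\<dots> \<le> exp (- 2 * B * (real j / sqrt N))"
      using mult_left_mono[OF j', of "2 * B"] B0 by simp
    also have "\<dots> = exp (- 2 * (B / sqrt N)) ^ j"
      by (simp add: exp_of_nat_mult[symmetric] mult_ac)
    also have "\<dots> \<le> (1 - B / sqrt N) ^ j"
      by (intro power_mono one_minus_ge_exp NB) (use B0 in auto)
    finally have e: "2 * c \<le> (1 - B / sqrt N) ^ j" .
    have "N \<ge> 1" using N1 by simp
    then have "sqrt (1 / (4 * N)) \<le> real (N choose (N div 2)) / 2 ^ N"
      by (intro real_le_lsqrt middle_binomial_bounds(2)) auto
    moreover have "sqrt (1 / (4 * N)) = 1 / (2 * sqrt N)"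
      by (simp add: real_sqrt_divide real_sqrt_mult)
    ultimately have m: "1 / (2 * sqrt N) \<le> real (N choose (N div 2)) / 2 ^ N" by simp
    have "c / sqrt N = 1 / (2 * sqrt N) * (2 * c)" by simp
    also have "\<dots> \<le> real (N choose (N div 2)) / 2 ^ N * (1 - B / sqrt N) ^ j"
      by (rule mult_mono[OF m e]) (auto simp: c_def)
    also have "\<dots> = (real (N choose (N div 2)) * (1 - B / sqrt N) ^ j) / 2 ^ N" by simp
    also have "\<dots> \<le> real (N choose l) / 2 ^ N"
      unfolding lj by (intro divide_right_mono binomial_offset_ge[OF assms B_def sq j]) auto
    finally show ?thesis .
  qed
  show ?thesis
  proof
    show "c > 0" by (simp add: c_def)
    fix N l assume N: "N \<ge> max 1 (max N0 (nat \<lceil>(2 * A)\<^sup>2\<rceil>))" and l: "\<bar>real l - real N / 2\<bar> \<le> A * sqrt N"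
    show "real (N choose l) / 2 ^ N \<ge> c / sqrt N"
    proof (cases "N div 2 \<le> l")
      case True
      then show ?thesis using upper[of N l] N l by auto
    next
      case False
      then have lN: "l \<le> N" by linarith
      have "real (N - l) - real N / 2 \<le> A * sqrt N" using l lN by (simp add: of_nat_diff)
      then have "real (N choose (N - l)) / 2 ^ N \<ge> c / sqrt N"
        using upper[of N "N - l"] N False by linarith
      then show ?thesis using binomial_symmetric[OF lN] by simp
    qed
  qed
qed

section \<open>Local limit estimates for critical offspring distributions\<close>

lemma fps_mult_nth_ge:
  fixes G H :: "real fps"
  assumes "\<And>i. G $ i \<ge> 0" "\<And>i. H $ i \<ge> 0"
  shows "G $ a * H $ b \<le> (G * H) $ (a + b)"
proof -
  have "G $ a * H $ b = (\<Sum>i\<in>{a}. G $ i * H $ (a + b - i))" by simp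
  also have "\<dots> \<le> (\<Sum>i=0..a + b. G $ i * H $ (a + b - i))"
    by (intro sum_mono2) (auto simp: assms)
  finally show ?thesis by (simp add: fps_mult_nth)
qed

lemma fps_mult_nonneg:
  fixes G H :: "real fps"
  assumes "\<And>i. G $ i \<ge> 0" "\<And>i. H $ i \<ge> 0"
  shows "(G * H) $ i \<ge> 0"
  unfolding fps_mult_nth by (intro sum_nonneg mult_nonneg_nonneg assms)

lemma fps_power_nonneg:
  fixes G :: "real fps"
  assumes "\<And>i. G $ i \<ge> 0"
  shows "(G ^ n) $ i \<ge> 0"
  using assms by (induction n arbitrary: i) (auto intro: fps_mult_nonneg)

text \<open>\<open>g\<close> is any offspring count above 1 of positive probability. It is the step
  of the coins in the local estimates, and its probability gives the quadratic loss in the survival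
  recursion.\<close>

locale critical_offspring =
  fixes p :: "nat \<Rightarrow> real" and g :: nat
  assumes p_nonneg: "p i \<ge> 0"
    and p_sums: "p sums 1"
    and p_mean: "(\<lambda>i. real i * p i) sums 1"
    and p_second: "summable (\<lambda>i. (real i)\<^sup>2 * p i)"
    and p_0: "p 0 > 0" and p_g: "p g > 0" and g_ge: "g \<ge> 2"
begin

section \<open>Decomposition of the offspring law into coins and a remainder\<close>

definition gf :: "real fps" where "gf = Abs_fps p"

definition \<theta> :: real where "\<theta> = min (p 0) (p g)"

definition coin :: "real fps" where "coin = fps_const (1 / 2) * (fps_X ^ g + 1)"

text \<open>
  The decomposition \<open>gf = \<theta> coin + (1 - \<theta>) rest\<close>: with probability \<open>\<theta>\<close> the offspring count is decided
  by a fair coin between \<open>0\<close> and \<open>g\<close>. The coefficients of \<open>bern ^ n\<close> are the law of the number of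
  coins among \<open>n\<close> vertices, and \<open>\<mu>\<close> is the mean of \<open>rest\<close>.
\<close>

definition rest :: "real fps" where
  "rest = Abs_fps (\<lambda>i. (p i - \<theta> * coin $ i) / (1 - \<theta>))"

definition bern :: "real fps" where "bern = fps_const \<theta> * fps_X + fps_const (1 - \<theta>)"

definition \<mu> :: real where "\<mu> = (1 - \<theta> * (real g / 2)) / (1 - \<theta>)"

lemma \<theta>_pos: "\<theta> > 0" and \<theta>_le: "\<theta> \<le> 1 / 2"
proof -
  show "\<theta> > 0" using p_0 p_g by (simp add: \<theta>_def)
  have "(\<Sum>i\<in>{0, g}. p i) \<le> 1"
    using sum_le_suminf[of p "{0, g}"] p_sums p_nonneg by (simp add: sums_iff)
  then show "\<theta> \<le> 1 / 2" using g_ge by (simp add: \<theta>_def)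
qed

lemma gf_nth [simp]: "gf $ i = p i" by (simp add: gf_def)

lemma coin_nth: "coin $ i = (if i = 0 then 1 / 2 else 0) + (if i = g then 1 / 2 else 0)"
  using g_ge by (simp add: coin_def)

lemma coin_sums: "(\<lambda>i. f i * coin $ i) sums ((f 0 + f g) / 2)"
proof -
  have "(\<lambda>i. (if i = 0 then f i / 2 else 0) + (if i = g then f i / 2 else 0)) sums (f 0 / 2 + f g / 2)"
    by (intro sums_add sums_single)
  moreover have "(if i = 0 then f i / 2 else 0) + (if i = g then f i / 2 else 0) = f i * coin $ i" for i
    by (simp add: coin_nth)
  ultimately show ?thesis by (simp add: add_divide_distrib)
qed

lemma rest_nth: "rest $ i = (p i - \<theta> * coin $ i) / (1 - \<theta>)"
  by (simp add: rest_def)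

text \<open>\<open>rest\<close> is nonnegative because the coin removes only \<theta>/2 at 0 and at
  \<open>g\<close>. One identity for an arbitrary \<open>f\<close> yields mass, mean and second
  moment; only finiteness of the last matters later.\<close>

lemma rest_moments: obtains s where "has_moments rest \<mu> s"
proof
  have nonneg: "rest $ i \<ge> 0" for i
    using \<theta>_pos \<theta>_le p_nonneg[of i] p_0 p_g g_ge
    by (auto simp: rest_nth coin_nth \<theta>_def intro!: divide_nonneg_nonneg)
  have "(\<lambda>i. (f i * p i - \<theta> * (f i * coin $ i)) / (1 - \<theta>)) sums ((m - \<theta> * ((f 0 + f g) / 2)) / (1 - \<theta>))"
    if "(\<lambda>i. f i * p i) sums m" for f m
    by (intro sums_divide sums_diff sums_mult coin_sums that)
  moreover have "(f i * p i - \<theta> * (f i * coin $ i)) / (1 - \<theta>) = f i * rest $ i" for f i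
    by (simp add: rest_nth right_diff_distrib mult.left_commute)
  ultimately have *: "(\<lambda>i. f i * rest $ i) sums ((m - \<theta> * ((f 0 + f g) / 2)) / (1 - \<theta>))"
    if "(\<lambda>i. f i * p i) sums m" for f m
    using that by simp
  show "has_moments rest \<mu> (((\<Sum>i. (real i)\<^sup>2 * p i) - \<theta> * ((real 0)\<^sup>2 + (real g)\<^sup>2) / 2) / (1 - \<theta>))"
    using *[of "\<lambda>_. 1" 1] *[of real 1] *[of "\<lambda>i. (real i)\<^sup>2", OF summable_sums] p_sums p_mean p_second nonneg \<theta>_le
    by (simp add: has_moments_def \<mu>_def)
qed

lemma mean_split: "\<theta> * (real g / 2) + (1 - \<theta>) * \<mu> = 1"
  using \<theta>_le by (simp add: \<mu>_def)

lemma gf_split: "gf = fps_const \<theta> * coin + fps_const (1 - \<theta>) * rest"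
  by (rule fps_ext) (use \<theta>_le in \<open>simp add: rest_nth\<close>)

lemma bern_nth: "bern $ i = (if i = 0 then 1 - \<theta> else 0) + (if i = 1 then \<theta> else 0)"
  by (simp add: bern_def)

lemma bern_moments: "has_moments bern \<theta> \<theta>"
proof -
  have "(\<lambda>i. f i * bern $ i) sums (f 0 * (1 - \<theta>) + f 1 * \<theta>)" for f
  proof -
    have "(\<lambda>i. (if i = 0 then f i * (1 - \<theta>) else 0) + (if i = 1 then f i * \<theta> else 0))
       sums (f 0 * (1 - \<theta>) + f 1 * \<theta>)"
      by (intro sums_add sums_single)
    moreover have "(if i = 0 then f i * (1 - \<theta>) else 0) + (if i = 1 then f i * \<theta> else 0) = f i * bern $ i" for i
      by (simp add: bern_nth)
    ultimately show ?thesis by simp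
  qed
  from this[of "\<lambda>_. 1"] this[of real] this[of "\<lambda>i. (real i)\<^sup>2"] show ?thesis
    using \<theta>_pos \<theta>_le by (simp add: has_moments_def bern_nth)
qed

lemma bern_power_nth: "(bern ^ n) $ N = real (n choose N) * \<theta> ^ N * (1 - \<theta>) ^ (n - N)"
proof -
  have "bern ^ n = (\<Sum>k\<le>n. fps_const (real (n choose k) * \<theta> ^ k * (1 - \<theta>) ^ (n - k)) * fps_X ^ k)"
    unfolding bern_def binomial_ring
    by (intro sum.cong refl) (simp add: power_mult_distrib fps_const_power fps_of_nat[symmetric] mult_ac)
  then have "(bern ^ n) $ N = (\<Sum>k\<le>n. if k = N then real (n choose k) * \<theta> ^ k * (1 - \<theta>) ^ (n - k) else 0)"
    by (simp add: fps_sum_nth if_distrib cong: if_cong)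
  then show ?thesis by (simp add: binomial_eq_0)
qed

lemma coin_power_nth: "(coin ^ N) $ m = (if g dvd m then real (N choose (m div g)) / 2 ^ N else 0)"
proof -
  have "coin ^ N = (\<Sum>k\<le>N. fps_const (real (N choose k) / 2 ^ N) * fps_X ^ (g * k))"
    unfolding coin_def power_mult_distrib binomial_ring sum_distrib_left
    by (intro sum.cong refl)
       (simp add: power_mult[symmetric] fps_const_power fps_of_nat[symmetric] power_one_over field_simps)
  then have *: "(coin ^ N) $ m = (\<Sum>k\<le>N. if m = g * k then real (N choose k) / 2 ^ N else 0)"
    by (simp add: fps_sum_nth if_distrib cong: if_cong)
  show ?thesis
  proof (cases "g dvd m")
    case True
    then obtain q where m: "m = g * q" by blast
    then have "(coin ^ N) $ m = (\<Sum>k\<le>N. if q = k then real (N choose k) / 2 ^ N else 0)"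
      using * g_ge by simp
    then show ?thesis using m g_ge by (simp add: binomial_eq_0)
  next
    case False
    then show ?thesis using * by (auto intro!: sum.neutral)
  qed
qed

text \<open>Conditioning on the number \<open>N\<close> of coins among \<open>n\<close> vertices.
  The spare factor \<open>H\<close> leaves room for the correction steps \<open>gf ^ K\<close> of
  the lower bound.\<close>

lemma gf_power_mult_nth:
  "(gf ^ n * H) $ j = (\<Sum>N\<le>n. (bern ^ n) $ N * (rest ^ (n - N) * (coin ^ N * H)) $ j)"
proof -
  have "gf ^ n * H = (\<Sum>N\<le>n. fps_const ((bern ^ n) $ N) * (rest ^ (n - N) * (coin ^ N * H)))"
    unfolding gf_split binomial_ring sum_distrib_right
    by (intro sum.cong refl)
       (simp add: bern_power_nth power_mult_distrib fps_const_power fps_of_nat[symmetric]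
          fps_const_mult[symmetric] mult_ac del: fps_const_mult)
  then show ?thesis by (simp add: fps_sum_nth)
qed

section \<open>Upper bound of order 1 / sqrt n for the coefficients of the n-th power\<close>

lemma gf_power_nonneg: "(gf ^ n) $ i \<ge> 0"
  by (intro fps_power_nonneg) (simp add: p_nonneg)

lemma coin_power_nonneg: "(coin ^ n) $ i \<ge> 0"
  by (intro fps_power_nonneg) (simp add: coin_nth)

lemma rest_nonneg: "rest $ i \<ge> 0"
  by (rule rest_moments) (rule has_moments_nonneg)

lemma rest_power_nonneg: "(rest ^ n) $ i \<ge> 0"
  by (intro fps_power_nonneg rest_nonneg)

lemma bern_power_nonneg: "(bern ^ n) $ i \<ge> 0"
  using \<theta>_pos \<theta>_le by (simp add: bern_power_nth)

lemma coin_power_le: "(coin ^ N) $ m \<le> 1 / sqrt (N + 1)"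
  using binomial_div_power_le[of N] by (simp add: coin_power_nth)

lemma bern_sum_le_1: "finite I \<Longrightarrow> (\<Sum>i\<in>I. (bern ^ n) $ i) \<le> 1"
  using has_moments_sum_le_1[OF has_moments_power[OF bern_moments]] by blast

text \<open>The mean of 1 / (N + 1) for a binomial \<open>N\<close>: absorbing N + 1 into the
  binomial coefficient gives probabilities of a binomial law with n + 1 trials.\<close>

lemma bern_inverse_moment: "(\<Sum>N\<le>n. (bern ^ n) $ N / (N + 1)) \<le> 1 / (\<theta> * (n + 1))"
proof -
  have eq: "(bern ^ n) $ N / (N + 1) * (\<theta> * (n + 1)) = (bern ^ (n + 1)) $ (N + 1)" for N
  proof -
    have "real (Suc N * (Suc n choose Suc N)) = real (Suc n * (n choose N))"
      by (simp only: Suc_times_binomial)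
    then have "real (Suc N) * real (Suc n choose Suc N) = real (Suc n) * real (n choose N)"
      by (simp only: of_nat_mult)
    then have "real (Suc n choose Suc N) = real (Suc n) * real (n choose N) / real (Suc N)"
      by (simp add: eq_divide_eq mult.commute del: of_nat_Suc binomial_Suc_Suc)
    then show ?thesis
      by (simp add: bern_power_nth mult_ac del: binomial_Suc_Suc power_Suc) (simp add: mult_ac)
  qed
  have "(\<Sum>N\<le>n. (bern ^ n) $ N / (N + 1)) * (\<theta> * (n + 1)) = (\<Sum>N\<le>n. (bern ^ (n + 1)) $ (N + 1))"
    unfolding sum_distrib_right eq ..
  also have "\<dots> = (\<Sum>N\<in>Suc ` {..n}. (bern ^ (n + 1)) $ N)"
    by (simp add: sum.reindex)
  also have "\<dots> \<le> 1" by (rule bern_sum_le_1) simp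
  finally show ?thesis
    using \<theta>_pos by (subst pos_le_divide_eq) auto
qed

text \<open>Given \<open>N\<close> coins, convolution with \<open>rest\<close> cannot raise the
  maximal coefficient, which is at most 1 / sqrt(N + 1); it remains to average over
  \<open>N\<close>.\<close>

lemma gf_power_le: "(gf ^ n) $ j \<le> 1 / sqrt (\<theta> * (n + 1))"
proof -
  define s where "s = sqrt (\<theta> * (n + 1))"
  have s: "s > 0" "s\<^sup>2 = \<theta> * (n + 1)" using \<theta>_pos by (auto simp: s_def)
  have R: "(rest ^ (n - N) * coin ^ N) $ j \<le> 1 / sqrt (N + 1)" for N
  proof -
    obtain s where "has_moments rest \<mu> s" by (rule rest_moments)
    then have le1: "(\<Sum>i=0..j. (rest ^ (n - N)) $ i) \<le> 1"
      using has_moments_sum_le_1[OF has_moments_power] by blast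
    have "(rest ^ (n - N) * coin ^ N) $ j = (\<Sum>i=0..j. (rest ^ (n - N)) $ i * (coin ^ N) $ (j - i))"
      by (simp add: fps_mult_nth)
    also have "\<dots> \<le> (\<Sum>i=0..j. (rest ^ (n - N)) $ i * (1 / sqrt (N + 1)))"
      by (intro sum_mono mult_left_mono coin_power_le rest_power_nonneg)
    also have "\<dots> = (\<Sum>i=0..j. (rest ^ (n - N)) $ i) * (1 / sqrt (N + 1))"
      by (simp only: sum_distrib_right)
    also have "\<dots> \<le> 1 * (1 / sqrt (N + 1))"
      by (intro mult_right_mono le1) simp
    finally show ?thesis by simp
  qed
  \<comment> \<open>AM-GM replaces the inverse root by the inverse, whose mean is known; with this
    \<open>s\<close> both halves contribute 1 / (2s).\<close>
  have amgm: "1 / sqrt (N + 1) \<le> (s / (N + 1) + 1 / s) / 2" for N :: nat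
  proof -
    define a where "a = 1 / sqrt (N + 1)"
    have "a\<^sup>2 = 1 / (N + 1)" by (simp add: a_def power_divide)
    moreover have "2 * s * a \<le> s\<^sup>2 * a\<^sup>2 + 1"
      using sum_squares_bound[of "s * a" 1] by (simp add: power_mult_distrib)
    moreover have "s * (s * a\<^sup>2 + 1 / s) = s\<^sup>2 * a\<^sup>2 + 1"
      using s(1) by (simp add: distrib_left power2_eq_square)
    ultimately have "s * (2 * a) \<le> s * (s * (1 / (N + 1)) + 1 / s)"
      by (simp add: mult_ac)
    then have "2 * a \<le> s * (1 / (N + 1)) + 1 / s"
      using s(1) by (rule mult_left_le_imp_le)
    then show ?thesis by (simp add: a_def)
  qed
  have "(gf ^ n) $ j = (\<Sum>N\<le>n. (bern ^ n) $ N * (rest ^ (n - N) * coin ^ N) $ j)"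
    using gf_power_mult_nth[of n 1 j] by simp
  also have "\<dots> \<le> (\<Sum>N\<le>n. (bern ^ n) $ N * ((s / (N + 1) + 1 / s) / 2))"
    by (intro sum_mono mult_left_mono order_trans[OF R amgm] bern_power_nonneg)
  also have "\<dots> = s / 2 * (\<Sum>N\<le>n. (bern ^ n) $ N / (N + 1)) + 1 / (2 * s) * (\<Sum>N\<le>n. (bern ^ n) $ N)"
    unfolding sum_distrib_left sum.distrib[symmetric]
    by (intro sum.cong refl) (simp add: distrib_left add_divide_distrib mult_ac)
  also have "\<dots> \<le> s / 2 * (1 / s\<^sup>2) + 1 / (2 * s) * 1"
    unfolding s(2) using s(1) by (intro add_mono mult_left_mono bern_inverse_moment bern_sum_le_1) auto
  also have "\<dots> = 1 / s" using s(1) by (simp add: field_simps power2_eq_square)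
  finally show ?thesis by (simp add: s_def)
qed

section \<open>Attainable sums and the matching lower bound\<close>

lemma gf_power_pos_of_rest:
  assumes "(rest ^ m) $ R > 0"
  shows "(gf ^ m) $ R > 0"
proof -
  have "(gf ^ m * 1) $ R = (\<Sum>N\<le>m. (bern ^ m) $ N * (rest ^ (m - N) * (coin ^ N * 1)) $ R)"
    by (rule gf_power_mult_nth)
  also have "\<dots> \<ge> (\<Sum>N\<in>{0}. (bern ^ m) $ N * (rest ^ (m - N) * (coin ^ N * 1)) $ R)"
    by (intro sum_mono2)
       (auto intro!: mult_nonneg_nonneg fps_mult_nonneg bern_power_nonneg rest_power_nonneg coin_power_nonneg)
  finally have "(bern ^ m) $ 0 * (rest ^ m) $ R \<le> (gf ^ m) $ R" by simp
  moreover have "(bern ^ m) $ 0 > 0" using \<theta>_le by (simp add: bern_power_nth)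
  ultimately show ?thesis using less_le_trans[OF mult_pos_pos[OF _ assms]] by blast
qed

lemma gf_power_pos_add:
  assumes "(gf ^ m) $ a > 0" "(gf ^ m') $ b > 0"
  shows "(gf ^ (m + m')) $ (a + b) > 0"
  unfolding power_add
  by (rule less_le_trans[OF mult_pos_pos[OF assms]], intro fps_mult_nth_ge gf_power_nonneg)

lemma gf_power_pos_mult:
  assumes "(gf ^ m) $ a > 0"
  shows "(gf ^ (k * m)) $ (k * a) > 0"
proof (induction k)
  case (Suc k)
  show ?case using gf_power_pos_add[OF assms Suc] by simp
qed simp

text \<open>The additional summands can all be 0, since \<open>p 0\<close> is positive.\<close>

lemma gf_power_pos_mono:
  assumes "(gf ^ m) $ a > 0" "m \<le> K"
  shows "(gf ^ K) $ a > 0"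
proof -
  have "(gf ^ (K - m)) $ 0 > 0" by (simp add: fps_power_zeroth p_0)
  from gf_power_pos_add[OF assms(1) this] show ?thesis using assms(2) by simp
qed

text \<open>
  Coins move a sum by multiples of \<open>g\<close> only. The residues modulo \<open>g\<close> attainable by sums form a finite
  submonoid of a group, hence a subgroup, so a bounded number \<open>K\<close> of additional steps can turn any
  attainable residue into any other with probability at least \<open>\<delta>\<close>.
\<close>

lemma residue_correction:
  obtains K C \<delta> where "\<delta> > 0"
    "\<And>a b m m'. (gf ^ m) $ a > 0 \<Longrightarrow> (gf ^ m') $ b > 0 \<Longrightarrow>
       \<exists>c\<le>C. (gf ^ K) $ c \<ge> \<delta> \<and> (b + c) mod g = a mod g"
proof -
  define S where "S = {r. r < g \<and> (\<exists>m c. (gf ^ m) $ c > 0 \<and> c mod g = r)}"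
  have finS: "finite S" by (simp add: S_def)
  have "\<forall>r\<in>S. \<exists>mc. (gf ^ fst mc) $ snd mc > 0 \<and> snd mc mod g = r"
  proof
    fix r assume "r \<in> S"
    then obtain m c where "(gf ^ m) $ c > 0" "c mod g = r" by (auto simp: S_def)
    then show "\<exists>mc. (gf ^ fst mc) $ snd mc > 0 \<and> snd mc mod g = r"
      by (intro exI[of _ "(m, c)"]) simp
  qed
  from bchoice[OF this] obtain f
    where "\<forall>r\<in>S. (gf ^ fst (f r)) $ snd (f r) > 0 \<and> snd (f r) mod g = r" ..
  then have f: "(gf ^ fst (f r)) $ snd (f r) > 0" "snd (f r) mod g = r" if "r \<in> S" for r
    using that by simp_all
  \<comment> \<open>A sum dominates each of its terms, so all residues are attained with the same
    number of steps \<open>K\<close>.\<close>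
  define K where "K = (\<Sum>r\<in>S. fst (f r))"
  define C where "C = (\<Sum>r\<in>S. snd (f r))"
  \<comment> \<open>Inserting 1 makes the minimum well-defined without having to know that
    \<open>S\<close> is nonempty.\<close>
  define \<delta> where "\<delta> = Min (insert 1 ((\<lambda>r. (gf ^ K) $ snd (f r)) ` S))"
  have pos: "(gf ^ K) $ snd (f r) > 0" if "r \<in> S" for r
  proof (rule gf_power_pos_mono[OF f(1)[OF that]])
    show "fst (f r) \<le> K" unfolding K_def by (rule member_le_sum[OF that _ finS]) simp
  qed
  show ?thesis
  proof
    show "\<delta> > 0" unfolding \<delta>_def using finS pos by (subst Min_gr_iff) auto
    fix a b m m' assume ab: "(gf ^ m) $ a > 0" "(gf ^ m') $ b > 0"
    \<comment> \<open>The residue of a - b modulo \<open>g\<close>, obtained without subtraction: b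
      + c = a + g b.\<close>
    define c where "c = a + (g - 1) * b"
    define r where "r = c mod g"
    have "(gf ^ (m + (g - 1) * m')) $ c > 0"
      unfolding c_def by (intro gf_power_pos_add gf_power_pos_mult ab)
    moreover have "r < g" using g_ge by (simp add: r_def)
    ultimately have r: "r \<in> S" unfolding S_def r_def by blast
    have "b + c = a + g * b" using g_ge by (cases g) (auto simp: c_def)
    then have "(b + c) mod g = a mod g" by simp
    moreover have "(b + snd (f r)) mod g = (b + c) mod g"
      using f(2)[OF r] mod_add_right_eq[of b "snd (f r)" g] mod_add_right_eq[of b c g]
      by (simp only: r_def)
    moreover have "snd (f r) \<le> C" unfolding C_def by (rule member_le_sum[OF r _ finS]) simp
    moreover have "\<delta> \<le> (gf ^ K) $ snd (f r)" unfolding \<delta>_def using finS r by (intro Min_le) auto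
    ultimately show "\<exists>c\<le>C. (gf ^ K) $ c \<ge> \<delta> \<and> (b + c) mod g = a mod g"
      by (intro exI[of _ "snd (f r)"]) simp
  qed
qed

text \<open>Of the \<open>n\<close> summands, \<open>K\<close> are reserved. For typical numbers
  \<open>N\<close> of coins and typical sums \<open>R\<close> of the remainder, the reserved steps
  contribute some \<open>c\<close> that makes n - 1 - R - c divisible by \<open>g\<close>. The coins
  must supply this amount, which is within O(sqrt n) of their mean, so the binomial lower bound
  applies.\<close>

lemma gf_power_ge:
  obtains c n0 where "c > 0"
    "\<And>n. n \<ge> n0 \<Longrightarrow> (gf ^ n) $ (n - 1) > 0 \<Longrightarrow> (gf ^ n) $ (n - 1) \<ge> c / sqrt n"
proof -
  obtain A1 where A1: "A1 > 0" "\<And>n. finite {j. \<bar>real j - real n * \<theta>\<bar> \<le> A1 * sqrt n}"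
    "\<And>n. (\<Sum>j | \<bar>real j - real n * \<theta>\<bar> \<le> A1 * sqrt n. (bern ^ n) $ j) \<ge> 1 / 2"
    using has_moments_concentration[OF bern_moments] by metis
  obtain s where s: "has_moments rest \<mu> s" by (rule rest_moments)
  obtain A2 where A2: "A2 > 0" "\<And>n. finite {j. \<bar>real j - real n * \<mu>\<bar> \<le> A2 * sqrt n}"
    "\<And>n. (\<Sum>j | \<bar>real j - real n * \<mu>\<bar> \<le> A2 * sqrt n. (rest ^ n) $ j) \<ge> 1 / 2"
    using has_moments_concentration[OF s] by metis
  obtain K C \<delta> where \<delta>: "\<delta> > 0"
    "\<And>a b m m'. (gf ^ m) $ a > 0 \<Longrightarrow> (gf ^ m') $ b > 0 \<Longrightarrow>
       \<exists>c\<le>C. (gf ^ K) $ c \<ge> \<delta> \<and> (b + c) mod g = a mod g"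
    using residue_correction by metis
  \<comment> \<open>The deviation of the required coin total from g N / 2 has three sources: the
    remainder, the number of coins, and the bounded correction. \<open>A\<close> converts it to
    units of sqrt N, using n' \<le> 2 N / \<theta>, and to multiples of \<open>g\<close>.\<close>
  define A3 where "A3 = A2 + A1 * \<bar>\<mu> - g / 2\<bar> + (real K + real C + 1)"
  define A where "A = A3 * sqrt (2 / \<theta>) / g"
  have A3: "A3 > 0" using A1(1) A2(1) unfolding A3_def by (intro add_pos_pos add_pos_nonneg mult_nonneg_nonneg) auto
  then have A: "A > 0" using \<theta>_pos g_ge by (auto simp: A_def intro!: divide_pos_pos mult_pos_pos)
  obtain cb N0 where cb: "cb > 0"
    "\<And>N l. N \<ge> N0 \<Longrightarrow> \<bar>real l - real N / 2\<bar> \<le> A * sqrt N \<Longrightarrow> real (N choose l) / 2 ^ N \<ge> cb / sqrt N"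
    using binomial_div_power_ge[OF A] by metis
  \<comment> \<open>The first summand ensures N \<ge> \<theta> n' / 2 for typical \<open>N\<close>;
    the second then ensures N \<ge> N0 and A sqrt N \<le> N / 2.\<close>
  define n1 where "n1 = nat \<lceil>(2 * A1 / \<theta>)\<^sup>2 + 2 / \<theta> * (real N0 + 4 * A\<^sup>2 + 1)\<rceil>"
  show ?thesis
  proof
    \<comment> \<open>The 4 is the loss from two concentration events, each of mass at least
      1/2.\<close>
    show "\<delta> * cb / 4 > 0" using \<delta>(1) cb(1) by simp
    fix n assume n: "n \<ge> K + n1" and pos: "(gf ^ n) $ (n - 1) > 0"
    define n' where "n' = n - K"
    have n': "n = n' + K" "n' \<ge> n1" using n by (auto simp: n'_def)
    have n'_ge: "(2 * A1 / \<theta>)\<^sup>2 + 2 / \<theta> * (real N0 + 4 * A\<^sup>2 + 1) \<le> real n'"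
      using n'(2) unfolding n1_def by linarith
    have "(2 * A1 / \<theta>)\<^sup>2 \<le> real n'"
      using n'_ge \<theta>_pos by (smt (verit) divide_pos_pos mult_pos_pos of_nat_0_le_iff zero_le_power2)
    then have "2 * A1 / \<theta> \<le> sqrt n'" by (rule real_le_rsqrt)
    then have "A1 \<le> \<theta> / 2 * sqrt n'" using \<theta>_pos by (simp add: field_simps)
    then have "A1 * sqrt n' \<le> \<theta> / 2 * sqrt n' * sqrt n'" by (intro mult_right_mono) auto
    then have A1n: "A1 * sqrt n' \<le> \<theta> * n' / 2" by (simp add: mult.assoc)
    have "2 / \<theta> * (real N0 + 4 * A\<^sup>2 + 1) \<le> real n'"
      using n'_ge by (smt (verit) zero_le_power2)
    then have n'_big: "real N0 + 4 * A\<^sup>2 + 1 \<le> \<theta> * n' / 2"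
      using \<theta>_pos by (simp add: field_simps)
    have "\<theta> * n' / 2 \<le> real n'" using \<theta>_le \<theta>_pos mult_right_mono[of \<theta> 1 "real n'"] by simp
    then have n'1: "real n' \<ge> 1" using n'_big zero_le_power2[of A] by linarith
    define X where "X = \<delta> * cb / sqrt n'"
    have X: "X > 0" using \<delta>(1) cb(1) n'1 by (simp add: X_def)
    define J1 where "J1 = {N. \<bar>real N - real n' * \<theta>\<bar> \<le> A1 * sqrt n'} \<inter> {..n'}"
    have inner: "(rest ^ (n' - N) * (coin ^ N * gf ^ K)) $ (n - 1) \<ge> X / 2" if N: "N \<in> J1" for N
    proof -
      have Nn: "N \<le> n'" and Nd: "\<bar>real N - real n' * \<theta>\<bar> \<le> A1 * sqrt n'"
        using N by (auto simp: J1_def)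
      have N2: "\<theta> * n' / 2 \<le> N" using Nd A1n by (simp add: abs_le_iff algebra_simps)
      have NN0: "N \<ge> N0" using N2 n'_big zero_le_power2[of A] by linarith
      have N1: "real N \<ge> 1" using N2 n'_big zero_le_power2[of A] by linarith
      have "(2 * A)\<^sup>2 \<le> real N" using N2 n'_big by (simp add: power_mult_distrib)
      then have sqN: "2 * A \<le> sqrt N" by (rule real_le_rsqrt)
      have "sqrt n' \<le> sqrt (2 / \<theta> * N)"
        using N2 \<theta>_pos by (intro real_sqrt_le_mono) (simp add: field_simps)
      then have "A3 * sqrt n' \<le> A3 * (sqrt (2 / \<theta>) * sqrt N)"
        using A3 by (intro mult_left_mono) (simp_all add: real_sqrt_mult[symmetric])
      also have "\<dots> = g * (A * sqrt N)" using g_ge by (simp add: A_def)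
      finally have A3n: "A3 * sqrt n' \<le> g * (A * sqrt N)" .
      \<comment> \<open>Residue correction needs attainable \<open>R\<close>; the discarded values
        carry no mass.\<close>
      define J2 where "J2 = {R. \<bar>real R - real (n' - N) * \<mu>\<bar> \<le> A2 * sqrt (n' - N)} \<inter> {R. (rest ^ (n' - N)) $ R > 0}"
      have J2: "R \<le> n - 1 \<and> (coin ^ N * gf ^ K) $ (n - 1 - R) \<ge> X" if R: "R \<in> J2" for R
      proof -
        have Rd: "\<bar>real R - real (n' - N) * \<mu>\<bar> \<le> A2 * sqrt (n' - N)"
          and Rp: "(rest ^ (n' - N)) $ R > 0" using R by (auto simp: J2_def)
        obtain c where c: "c \<le> C" "(gf ^ K) $ c \<ge> \<delta>" "(R + c) mod g = (n - 1) mod g"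
          using \<delta>(2)[OF pos gf_power_pos_of_rest[OF Rp]] by blast
        \<comment> \<open>The coin total as a real number: that R + c \<le> n - 1 is known only
          after y \<ge> 0 has been derived from the deviation bound.\<close>
        define y where "y = real n - 1 - real R - real c"
        have "y - g * (real N / 2) = - (real R - real (n' - N) * \<mu>) + (real N - real n' * \<theta>) * (\<mu> - g / 2)
            + (real K - 1 - real c)"
        proof -
          \<comment> \<open>Criticality: writing n' through the mean of the mixture cancels all
            terms of order n.\<close>
          have "real n' = real n' * (\<theta> * (real g / 2) + (1 - \<theta>) * \<mu>)"
            by (simp only: mean_split mult_1_right)
          then show ?thesis
            unfolding y_def n'(1) using Nn by (simp add: of_nat_diff algebra_simps)
        qed
        also have "\<bar>\<dots>\<bar> \<le> \<bar>real R - real (n' - N) * \<mu>\<bar> + \<bar>real N - real n' * \<theta>\<bar> * \<bar>\<mu> - g / 2\<bar>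
            + \<bar>real K - 1 - real c\<bar>"
        proof -
          have "\<bar>- x + y + z\<bar> \<le> \<bar>x\<bar> + \<bar>y\<bar> + \<bar>z\<bar>" for x y z :: real by linarith
          then show ?thesis unfolding abs_mult[symmetric] .
        qed
        also have "\<dots> \<le> A2 * sqrt n' + (A1 * sqrt n') * \<bar>\<mu> - g / 2\<bar> + (real K + real C + 1) * sqrt n'"
        proof (intro add_mono mult_right_mono Nd)
          have "A2 * sqrt (n' - N) \<le> A2 * sqrt n'" using A2(1) by (intro mult_left_mono) auto
          with Rd show "\<bar>real R - real (n' - N) * \<mu>\<bar> \<le> A2 * sqrt n'" by linarith
          have "\<bar>real K - 1 - real c\<bar> \<le> real K + real C + 1" using c(1) by linarith
          also have "\<dots> \<le> (real K + real C + 1) * sqrt n'"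
            using mult_left_mono[of 1 "sqrt n'" "real K + real C + 1"] n'1 by simp
          finally show "\<bar>real K - 1 - real c\<bar> \<le> (real K + real C + 1) * sqrt n'" .
        qed simp
        also have "\<dots> = A3 * sqrt n'" by (simp add: A3_def algebra_simps)
        also have "\<dots> \<le> g * (A * sqrt N)" by (rule A3n)
        finally have y: "\<bar>y - g * (real N / 2)\<bar> \<le> g * (A * sqrt N)" .
        have "A * sqrt N \<le> sqrt N / 2 * sqrt N" using sqN by (intro mult_right_mono) auto
        then have "g * (A * sqrt N) \<le> g * (real N / 2)" by (intro mult_left_mono) auto
        with y have "y \<ge> 0" by linarith
        then have le: "R + c \<le> n - 1" unfolding y_def by linarith
        have "g dvd n - 1 - (R + c)"
          using c(3) le by (metis mod_eq_dvd_iff_nat)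
        then obtain l where l: "n - 1 - (R + c) = g * l" by blast
        have "n \<ge> 1" using n'1 n'(1) by simp
        then have "y = real (n - 1 - (R + c))" unfolding y_def using le by (simp add: of_nat_diff)
        then have yl: "y = g * real l" using l by simp
        have "real g * \<bar>real l - real N / 2\<bar> = \<bar>y - g * (real N / 2)\<bar>"
          unfolding yl right_diff_distrib[symmetric] abs_mult by simp
        with y have "real g * \<bar>real l - real N / 2\<bar> \<le> real g * (A * sqrt N)" by simp
        then have "\<bar>real l - real N / 2\<bar> \<le> A * sqrt N" using g_ge by (subst (asm) mult_le_cancel_left_pos) auto
        from cb(2)[OF NN0 this] have "cb / sqrt N \<le> (coin ^ N) $ (n - 1 - (R + c))"
          unfolding l using g_ge by (simp add: coin_power_nth)
        moreover have "cb / sqrt n' \<le> cb / sqrt N"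
          using cb(1) N1 Nn by (intro divide_left_mono) auto
        ultimately have "cb / sqrt n' \<le> (coin ^ N) $ (n - 1 - (R + c))" by linarith
        then have "cb / sqrt n' * \<delta> \<le> (coin ^ N) $ (n - 1 - (R + c)) * (gf ^ K) $ c"
          using c(2) \<delta>(1) cb(1) by (intro mult_mono coin_power_nonneg) auto
        also have "\<dots> \<le> (coin ^ N * gf ^ K) $ (n - 1 - (R + c) + c)"
          by (intro fps_mult_nth_ge coin_power_nonneg gf_power_nonneg)
        also have "n - 1 - (R + c) + c = n - 1 - R" using le by simp
        finally show ?thesis using le by (simp add: X_def mult.commute)
      qed
      have finJ2: "finite J2" unfolding J2_def using A2(2)[of "n' - N"] by simp
      have "1 / 2 \<le> (\<Sum>R | \<bar>real R - real (n' - N) * \<mu>\<bar> \<le> A2 * sqrt (n' - N). (rest ^ (n' - N)) $ R)"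
        by (rule A2(3))
      also have "\<dots> = (\<Sum>R\<in>J2. (rest ^ (n' - N)) $ R)"
      proof (rule sum.mono_neutral_right)
        show "\<forall>R\<in>{R. \<bar>real R - real (n' - N) * \<mu>\<bar> \<le> A2 * sqrt (n' - N)} - J2. (rest ^ (n' - N)) $ R = 0"
        proof
          fix R assume "R \<in> {R. \<bar>real R - real (n' - N) * \<mu>\<bar> \<le> A2 * sqrt (n' - N)} - J2"
          then have "\<not> (rest ^ (n' - N)) $ R > 0" by (auto simp: J2_def)
          with rest_power_nonneg[of "n' - N" R] show "(rest ^ (n' - N)) $ R = 0" by linarith
        qed
      qed (auto simp: J2_def A2(2))
      finally have half: "1 / 2 \<le> (\<Sum>R\<in>J2. (rest ^ (n' - N)) $ R)" .
      have "X / 2 \<le> (\<Sum>R\<in>J2. (rest ^ (n' - N)) $ R) * X"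
        using mult_right_mono[OF half, of X] X by simp
      also have "\<dots> = (\<Sum>R\<in>J2. (rest ^ (n' - N)) $ R * X)" by (simp add: sum_distrib_right)
      also have "\<dots> \<le> (\<Sum>R\<in>J2. (rest ^ (n' - N)) $ R * (coin ^ N * gf ^ K) $ (n - 1 - R))"
        using J2 by (intro sum_mono mult_left_mono rest_power_nonneg) auto
      also have "\<dots> \<le> (\<Sum>R=0..n - 1. (rest ^ (n' - N)) $ R * (coin ^ N * gf ^ K) $ (n - 1 - R))"
        using J2 by (intro sum_mono2)
          (auto intro!: mult_nonneg_nonneg fps_mult_nonneg rest_power_nonneg coin_power_nonneg gf_power_nonneg)
      also have "\<dots> = (rest ^ (n' - N) * (coin ^ N * gf ^ K)) $ (n - 1)" by (simp add: fps_mult_nth)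
      finally show ?thesis .
    qed
    have "1 / 2 \<le> (\<Sum>j | \<bar>real j - real n' * \<theta>\<bar> \<le> A1 * sqrt n'. (bern ^ n') $ j)" by (rule A1(3))
    also have "\<dots> = (\<Sum>N\<in>J1. (bern ^ n') $ N)"
      by (rule sum.mono_neutral_right) (auto simp: J1_def A1(2) bern_power_nth)
    finally have half: "1 / 2 \<le> (\<Sum>N\<in>J1. (bern ^ n') $ N)" .
    have "X / 4 \<le> (\<Sum>N\<in>J1. (bern ^ n') $ N) * (X / 2)"
      using mult_right_mono[OF half, of "X / 2"] X by simp
    also have "\<dots> = (\<Sum>N\<in>J1. (bern ^ n') $ N * (X / 2))" by (simp only: sum_distrib_right)
    also have "\<dots> \<le> (\<Sum>N\<in>J1. (bern ^ n') $ N * (rest ^ (n' - N) * (coin ^ N * gf ^ K)) $ (n - 1))"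
      using inner by (intro sum_mono mult_left_mono bern_power_nonneg) auto
    also have "\<dots> \<le> (\<Sum>N\<le>n'. (bern ^ n') $ N * (rest ^ (n' - N) * (coin ^ N * gf ^ K)) $ (n - 1))"
      by (intro sum_mono2)
        (auto simp: J1_def intro!: mult_nonneg_nonneg fps_mult_nonneg bern_power_nonneg rest_power_nonneg coin_power_nonneg gf_power_nonneg)
    also have "\<dots> = (gf ^ n' * gf ^ K) $ (n - 1)" by (rule gf_power_mult_nth[symmetric])
    also have "gf ^ n' * gf ^ K = gf ^ n" by (simp add: n'(1) power_add)
    finally have "X / 4 \<le> (gf ^ n) $ (n - 1)" .
    moreover have "\<delta> * cb / 4 / sqrt n \<le> \<delta> * cb / 4 / sqrt n'"
      using \<delta>(1) cb(1) n'1 n'(1) by (intro divide_left_mono) auto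
    ultimately show "(gf ^ n) $ (n - 1) \<ge> \<delta> * cb / 4 / sqrt n" by (simp add: X_def)
  qed
qed

end

section \<open>Weighted plane trees\<close>

text \<open>The finite plane trees, in a form that admits recursion at the root;
  \<open>verts\<close> translates them into Ulam--Harris vertex sets.\<close>

datatype ptree = Node "ptree list"

fun num_verts :: "ptree \<Rightarrow> nat" where
  "num_verts (Node ts) = Suc (sum_list (map num_verts ts))"

text \<open>The probability that the Galton--Watson tree with offspring law \<open>p\<close> equals
  the given tree.\<close>

fun weight :: "(nat \<Rightarrow> real) \<Rightarrow> ptree \<Rightarrow> real" where
  "weight p (Node ts) = p (length ts) * prod_list (map (weight p) ts)"

text \<open>Height at least \<open>k\<close>; recursion on \<open>k\<close> matches the recursion of
  survival probabilities over generations.\<close>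

fun tall :: "nat \<Rightarrow> ptree \<Rightarrow> bool" where
  "tall 0 t \<longleftrightarrow> True"
| "tall (Suc k) (Node ts) \<longleftrightarrow> (\<exists>t\<in>set ts. tall k t)"

fun num_tall :: "nat \<Rightarrow> ptree \<Rightarrow> nat" where
  "num_tall k (Node ts) = of_bool (tall k (Node ts)) + sum_list (map (num_tall k) ts)"

fun is_vert :: "ptree \<Rightarrow> nat list \<Rightarrow> bool" where
  "is_vert t [] \<longleftrightarrow> True"
| "is_vert (Node ts) (i # v) \<longleftrightarrow> i < length ts \<and> is_vert (ts ! i) v"

definition verts :: "ptree \<Rightarrow> nat list set" where
  "verts t = {v. is_vert t v}"

text \<open>Meaningful only at vertices, because \<open>ts ! i\<close> is unspecified out of
  range.\<close>

fun nchildren :: "ptree \<Rightarrow> nat list \<Rightarrow> nat" where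
  "nchildren (Node ts) [] = length ts"
| "nchildren (Node ts) (i # v) = nchildren (ts ! i) v"

section \<open>Vertex sets and the residue classes\<close>

lemma Nil_in_verts [simp]: "[] \<in> verts t"
  by (simp add: verts_def)

lemma verts_Node: "verts (Node ts) = insert [] (\<Union>i<length ts. (#) i ` verts (ts ! i))"
proof (intro equalityI subsetI)
  fix v assume "v \<in> verts (Node ts)"
  then show "v \<in> insert [] (\<Union>i<length ts. (#) i ` verts (ts ! i))"
    by (cases v) (auto simp: verts_def)
qed (auto simp: verts_def)

lemma finite_verts [simp]: "finite (verts t)"
  by (induction t) (auto simp: verts_Node intro!: finite_imageI)

lemma sum_verts_Node:
  "(\<Sum>v\<in>verts (Node ts). f v) = f [] + (\<Sum>i<length ts. \<Sum>v\<in>verts (ts ! i). f (i # v) :: nat)"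
proof -
  have "(\<Sum>v\<in>verts (Node ts). f v) = f [] + (\<Sum>v\<in>(\<Union>i<length ts. (#) i ` verts (ts ! i)). f v)"
    unfolding verts_Node by (subst sum.insert) auto
  also have "(\<Sum>v\<in>(\<Union>i<length ts. (#) i ` verts (ts ! i)). f v)
     = (\<Sum>i<length ts. \<Sum>v\<in>(#) i ` verts (ts ! i). f v)"
    by (rule sum.UNION_disjoint) auto
  also have "\<dots> = (\<Sum>i<length ts. \<Sum>v\<in>verts (ts ! i). f (i # v))"
    by (rule sum.cong[OF refl]) (simp add: sum.reindex)
  finally show ?thesis .
qed

lemma prod_verts_Node:
  "(\<Prod>v\<in>verts (Node ts). f v) = f [] * (\<Prod>i<length ts. \<Prod>v\<in>verts (ts ! i). f (i # v) :: real)"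
proof -
  have "(\<Prod>v\<in>verts (Node ts). f v) = f [] * (\<Prod>v\<in>(\<Union>i<length ts. (#) i ` verts (ts ! i)). f v)"
    unfolding verts_Node by (subst prod.insert) auto
  also have "(\<Prod>v\<in>(\<Union>i<length ts. (#) i ` verts (ts ! i)). f v)
     = (\<Prod>i<length ts. \<Prod>v\<in>(#) i ` verts (ts ! i). f v)"
    by (rule prod.UNION_disjoint) auto
  also have "\<dots> = (\<Prod>i<length ts. \<Prod>v\<in>verts (ts ! i). f (i # v))"
    by (rule prod.cong[OF refl]) (simp add: prod.reindex)
  finally show ?thesis .
qed

lemma sum_list_eq_sum_nth: "sum_list (map f xs) = (\<Sum>i<length xs. f (xs ! i) :: nat)"
  by (simp add: sum_list_sum_nth atLeast0LessThan)

lemma prod_list_eq_prod_nth: "prod_list (map f xs) = (\<Prod>i<length xs. f (xs ! i) :: real)"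
  by (induction xs) (simp_all add: prod.lessThan_Suc_shift del: prod.lessThan_Suc)

lemma card_verts: "card (verts t) = num_verts t"
proof (induction t)
  case (Node ts)
  have "card (verts (Node ts)) = 1 + (\<Sum>i<length ts. card (verts (ts ! i)))"
    using sum_verts_Node[of "\<lambda>_. 1" ts] by simp
  also have "\<dots> = 1 + (\<Sum>i<length ts. num_verts (ts ! i))"
    using Node by simp
  finally show ?case by (simp add: sum_list_eq_sum_nth)
qed

lemma prod_nchildren: "(\<Prod>v\<in>verts t. p (nchildren t v)) = weight p t"
proof (induction t)
  case (Node ts)
  have "(\<Prod>v\<in>verts (Node ts). p (nchildren (Node ts) v))
     = p (length ts) * (\<Prod>i<length ts. \<Prod>v\<in>verts (ts ! i). p (nchildren (ts ! i) v))"
    by (subst prod_verts_Node) simp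
  also have "\<dots> = p (length ts) * (\<Prod>i<length ts. weight p (ts ! i))"
    using Node by simp
  finally show ?case by (simp add: prod_list_eq_prod_nth)
qed

lemma tall_iff: "tall k t \<longleftrightarrow> (\<exists>w. is_vert t w \<and> k \<le> length w)"
proof (induction k t rule: tall.induct)
  case (1 t)
  then show ?case by (auto intro: exI[of _ "[]"])
next
  case (2 k ts)
  have "tall (Suc k) (Node ts) \<longleftrightarrow> (\<exists>t\<in>set ts. \<exists>w. is_vert t w \<and> k \<le> length w)"
    using 2 by auto
  also have "\<dots> \<longleftrightarrow> (\<exists>i w. i < length ts \<and> is_vert (ts ! i) w \<and> k \<le> length w)"
    by (metis in_set_conv_nth)
  also have "\<dots> \<longleftrightarrow> (\<exists>w. is_vert (Node ts) w \<and> Suc k \<le> length w)"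
  proof
    assume "\<exists>i w. i < length ts \<and> is_vert (ts ! i) w \<and> k \<le> length w"
    then obtain i w where "i < length ts \<and> is_vert (ts ! i) w \<and> k \<le> length w" by blast
    then show "\<exists>w. is_vert (Node ts) w \<and> Suc k \<le> length w"
      by (intro exI[of _ "i # w"]) simp
  next
    assume "\<exists>w. is_vert (Node ts) w \<and> Suc k \<le> length w"
    then obtain w where "is_vert (Node ts) w" "Suc k \<le> length w" by blast
    then show "\<exists>i w. i < length ts \<and> is_vert (ts ! i) w \<and> k \<le> length w"
      by (cases w) auto
  qed
  finally show ?case .
qed

lemma num_tall_eq_sum:
  "num_tall k t = (\<Sum>v\<in>verts t. of_bool (\<exists>w. is_vert t (v @ w) \<and> k \<le> length w))"
proof (induction t)
  case (Node ts)
  have "(\<Sum>v\<in>verts (Node ts). of_bool (\<exists>w. is_vert (Node ts) (v @ w) \<and> k \<le> length w))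
      = of_bool (tall k (Node ts)) + (\<Sum>i<length ts. \<Sum>v\<in>verts (ts ! i).
          of_bool (\<exists>w. is_vert (ts ! i) (v @ w) \<and> k \<le> length w) :: nat)"
    by (subst sum_verts_Node) (simp add: tall_iff)
  also have "\<dots> = of_bool (tall k (Node ts)) + (\<Sum>i<length ts. num_tall k (ts ! i))"
    using Node by simp
  finally show ?case by (simp add: sum_list_eq_sum_nth)
qed

lemma subtree_height_ge_iff:
  assumes "v \<in> verts t"
  shows "k \<le> subtree_height (verts t) v \<longleftrightarrow> (\<exists>w. is_vert t (v @ w) \<and> k \<le> length w)"
proof -
  have ne: "subtree_at (verts t) v \<noteq> {}"
    using assms by (auto simp: subtree_at_def)
  have fin: "finite (subtree_at (verts t) v)"
    by (rule finite_subset[OF _ finite_verts[of t]]) (auto simp: subtree_at_def)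
  have "k \<le> subtree_height (verts t) v \<longleftrightarrow> (\<exists>w\<in>subtree_at (verts t) v. k \<le> length w - length v)"
    unfolding subtree_height_def using ne fin by (subst Max_ge_iff) auto
  also have "\<dots> \<longleftrightarrow> (\<exists>w. is_vert t (v @ w) \<and> k \<le> length w)"
    by (auto simp: subtree_at_def verts_def prefix_def)
  finally show ?thesis .
qed

lemma card_tall_verts: "card {v \<in> verts t. k \<le> subtree_height (verts t) v} = num_tall k t"
proof -
  have "{v \<in> verts t. k \<le> subtree_height (verts t) v}
      = {v \<in> verts t. \<exists>w. is_vert t (v @ w) \<and> k \<le> length w}"
    using subtree_height_ge_iff by blast
  moreover have "card \<dots> = (\<Sum>v\<in>verts t. of_bool (\<exists>w. is_vert t (v @ w) \<and> k \<le> length w))"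
    by (simp add: Int_def)
  ultimately show ?thesis by (simp add: num_tall_eq_sum)
qed

lemma num_tall_le_num_verts: "num_tall k t \<le> num_verts t"
proof -
  have "card {v \<in> verts t. k \<le> subtree_height (verts t) v} \<le> card (verts t)"
    by (intro card_mono) auto
  then show ?thesis by (simp add: card_tall_verts card_verts)
qed

text \<open>The depth of a vertex of class \<open>j\<close> is congruent to \<open>j\<close> modulo
  \<open>k\<close>, so the classes are disjoint.\<close>

lemma sum_card_C_set_le: "(\<Sum>j<k. card (C_set k j (verts t))) \<le> num_tall k t"
proof (cases "k = 0")
  case False
  have len: "length v mod k = j" if "v \<in> C_set k j (verts t)" "j < k" for v j
    using that by (auto simp: C_set_def level_def)
  have sub: "C_set k j (verts t) \<subseteq> {v \<in> verts t. k \<le> subtree_height (verts t) v}" for j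
    by (auto simp: C_set_def level_def)
  have fin: "finite (C_set k j (verts t))" for j
    by (rule finite_subset[OF sub]) auto
  have "C_set k i (verts t) \<inter> C_set k j (verts t) = {}" if "i < k" "j < k" "i \<noteq> j" for i j
    using len that by blast
  then have "(\<Sum>j<k. card (C_set k j (verts t))) = card (\<Union>j<k. C_set k j (verts t))"
    using fin by (subst card_UN_disjoint) auto
  also have "\<dots> \<le> card {v \<in> verts t. k \<le> subtree_height (verts t) v}"
    using sub by (intro card_mono) auto
  finally show ?thesis by (simp add: card_tall_verts)
qed simp

text \<open>Each of the \<open>k\<close> classes then has at least 2k elements. Positivity of
  \<open>k\<close> keeps the minimum off the empty set.\<close>

lemma Min_C_set_bound:
  assumes "k > 0" and "\<not> int (Min ((\<lambda>j. card (C_set k j (verts t))) ` {0..<k})) \<le> 2 * int k - 1"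
  shows "2 * k * k \<le> num_tall k t"
proof -
  have "2 * k \<le> Min ((\<lambda>j. card (C_set k j (verts t))) ` {0..<k})"
    using assms(2) by linarith
  then have "2 * k \<le> card (C_set k j (verts t))" if "j < k" for j
    using that assms(1) by (subst (asm) Min_ge_iff) auto
  then have "(\<Sum>j<k. 2 * k) \<le> (\<Sum>j<k. card (C_set k j (verts t)))"
    by (intro sum_mono) auto
  with sum_card_C_set_le[of k t] show ?thesis by simp
qed

section \<open>Offspring trees as plane trees\<close>

lemma snoc_in_offspring_tree: "v @ [i] \<in> offspring_tree c \<longleftrightarrow> v \<in> offspring_tree c \<and> i < c v"
  by (subst offspring_tree.simps) auto

text \<open>The inductive definition grows at the end of a list, whereas plane trees recurse at the
  root; this lemma changes sides.\<close>

lemma Cons_in_offspring_tree: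
  "i # v \<in> offspring_tree c \<longleftrightarrow> i < c [] \<and> v \<in> offspring_tree (\<lambda>v. c (i # v))"
proof (induction v rule: rev_induct)
  case Nil
  show ?case
    using snoc_in_offspring_tree[of "[]" i c] by (simp add: offspring_tree.root)
next
  case (snoc j v)
  show ?case
    unfolding append_Cons[symmetric] snoc_in_offspring_tree snoc by blast
qed

text \<open>A vertex set determines its offspring counts, and these determine the tree. The event of
  seeing a given tree thus becomes finitely many constraints on independent variables.\<close>

lemma offspring_tree_eq_verts_iff:
  "offspring_tree c = verts t \<longleftrightarrow> (\<forall>v\<in>verts t. c v = nchildren t v)"
proof
  have snoc: "{i. is_vert t (v @ [i])} = {..<nchildren t v}" if "is_vert t v" for t v
    using that by (induction t v rule: nchildren.induct) (simp_all add: lessThan_def)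
  assume eq: "offspring_tree c = verts t"
  show "\<forall>v\<in>verts t. c v = nchildren t v"
  proof
    fix v assume v: "v \<in> verts t"
    then have "{i. v @ [i] \<in> offspring_tree c} = {..<c v}"
      unfolding snoc_in_offspring_tree using eq by (simp add: lessThan_def)
    moreover have "{i. v @ [i] \<in> offspring_tree c} = {..<nchildren t v}"
      unfolding eq using snoc[of t v] v by (simp add: verts_def)
    ultimately show "c v = nchildren t v" by simp
  qed
next
  assume "\<forall>v\<in>verts t. c v = nchildren t v"
  then have "v \<in> offspring_tree c \<longleftrightarrow> is_vert t v" for v
  proof (induction v arbitrary: t c)
    case Nil
    show ?case by (simp add: offspring_tree.root)
  next
    case (Cons i v)
    obtain ts where t: "t = Node ts" by (cases t)
    have "c [] = length ts"
      using bspec[OF Cons.prems, of "[]"] t by simp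
    moreover have "v \<in> offspring_tree (\<lambda>v. c (i # v)) \<longleftrightarrow> is_vert (ts ! i) v" if "i < length ts"
    proof (rule Cons.IH, intro ballI)
      fix u assume "u \<in> verts (ts ! i)"
      then have "i # u \<in> verts t" using that t by (simp add: verts_def)
      from bspec[OF Cons.prems this] show "c (i # u) = nchildren (ts ! i) u" using t by simp
    qed
    ultimately show ?case by (auto simp: Cons_in_offspring_tree t)
  qed
  then show "offspring_tree c = verts t" by (auto simp: verts_def)
qed

lemma verts_inject [simp]: "verts t = verts t' \<longleftrightarrow> t = t'"
proof
  show "verts t = verts t' \<Longrightarrow> t = t'"
  proof (induction t arbitrary: t')
    case (Node ts)
    obtain ts' where t': "t' = Node ts'" by (cases t')
    have eq: "is_vert (Node ts) v \<longleftrightarrow> is_vert (Node ts') v" for v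
      using Node.prems t' by (auto simp: verts_def set_eq_iff)
    have "i < length ts \<longleftrightarrow> i < length ts'" for i
      using eq[of "[i]"] by simp
    then have len: "length ts = length ts'"
      by (metis linorder_neqE_nat less_irrefl)
    have "ts ! i = ts' ! i" if "i < length ts" for i
    proof (rule Node.IH)
      show "ts ! i \<in> set ts" using that by simp
      have "is_vert (ts ! i) v = is_vert (ts' ! i) v" for v
        using eq[of "i # v"] that len by simp
      then show "verts (ts ! i) = verts (ts' ! i)" by (simp add: verts_def)
    qed
    with len t' show ?case by (auto intro: nth_equalityI)
  qed
qed simp

text \<open>Induction on the cardinality: the subtrees at the children of the root omit the root,
  hence are smaller.\<close>

lemma finite_offspring_tree_eq_verts:
  assumes "finite (offspring_tree c)"
  shows "\<exists>t. offspring_tree c = verts t"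
  using assms
proof (induction "card (offspring_tree c)" arbitrary: c rule: less_induct)
  case less
  have "\<exists>t. offspring_tree (\<lambda>v. c (i # v)) = verts t" if i: "i < c []" for i
  proof (rule less.hyps)
    have sub: "(#) i ` offspring_tree (\<lambda>v. c (i # v)) \<subseteq> offspring_tree c - {[]}"
      using i by (auto simp: Cons_in_offspring_tree)
    then have fin: "finite ((#) i ` offspring_tree (\<lambda>v. c (i # v)))"
      using finite_subset[OF sub] less.prems by simp
    show "finite (offspring_tree (\<lambda>v. c (i # v)))"
      using fin by (rule finite_imageD) simp
    have "card ((#) i ` offspring_tree (\<lambda>v. c (i # v))) \<le> card (offspring_tree c - {[]})"
      using sub less.prems by (intro card_mono) auto
    also have "\<dots> < card (offspring_tree c)"
      using less.prems offspring_tree.root by (rule card_Diff1_less)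
    finally show "card (offspring_tree (\<lambda>v. c (i # v))) < card (offspring_tree c)"
      by (simp add: card_image)
  qed
  then have "\<forall>i. \<exists>t. i < c [] \<longrightarrow> offspring_tree (\<lambda>v. c (i # v)) = verts t"
    by blast
  from choice[OF this] obtain s
    where s: "offspring_tree (\<lambda>v. c (i # v)) = verts (s i)" if "i < c []" for i
    by blast
  have "v \<in> offspring_tree c \<longleftrightarrow> v \<in> verts (Node (map s [0..<c []]))" for v
  proof (cases v)
    case (Cons i u)
    have "v \<in> offspring_tree c \<longleftrightarrow> i < c [] \<and> u \<in> offspring_tree (\<lambda>v. c (i # v))"
      unfolding Cons by (rule Cons_in_offspring_tree)
    also have "\<dots> \<longleftrightarrow> i < c [] \<and> u \<in> verts (s i)"
      by (rule conj_cong[OF refl]) (simp only: s)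
    also have "\<dots> \<longleftrightarrow> v \<in> verts (Node (map s [0..<c []]))"
      unfolding Cons by (auto simp: verts_def)
    finally show ?thesis .
  qed (simp add: offspring_tree.root)
  then have "offspring_tree c = verts (Node (map s [0..<c []]))" by (rule set_eqI)
  then show ?case by (rule exI)
qed

section \<open>Enumeration of trees and forests by number of vertices\<close>

lemma num_verts_pos [simp]: "num_verts t > 0"
  by (cases t) simp

lemma num_verts_neq_0 [simp]: "num_verts t \<noteq> 0"
  using num_verts_pos[of t] by linarith

lemma length_le_sum_num_verts: "length ts \<le> sum_list (map num_verts ts)"
proof (induction ts)
  case (Cons t ts)
  then show ?case by (cases t) simp
qed simp

lemma finite_num_verts_le: "finite {t. num_verts t \<le> n}"
proof (induction n)
  case (Suc n)
  have "{t. num_verts t \<le> Suc n} \<subseteq> Node ` {ts. set ts \<subseteq> {t. num_verts t \<le> n} \<and> length ts \<le> n}"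
  proof
    fix t assume "t \<in> {t. num_verts t \<le> Suc n}"
    moreover obtain ts where t: "t = Node ts" by (cases t)
    ultimately have le: "sum_list (map num_verts ts) \<le> n" by simp
    have "num_verts u \<le> n" if "u \<in> set ts" for u
      using member_le_sum_list[of "num_verts u" "map num_verts ts"] that le by auto
    moreover have "length ts \<le> n" using length_le_sum_num_verts[of ts] le by simp
    ultimately show "t \<in> Node ` {ts. set ts \<subseteq> {t. num_verts t \<le> n} \<and> length ts \<le> n}"
      using t by blast
  qed
  then show ?case
    using finite_lists_length_le[OF Suc] by (meson finite_imageI finite_subset)
qed simp

lemma finite_num_verts_eq [simp]: "finite {t. num_verts t = n}"
  by (rule finite_subset[OF _ finite_num_verts_le[of n]]) auto

definition forests :: "nat \<Rightarrow> nat \<Rightarrow> ptree list set" where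
  "forests i n = {ts. length ts = i \<and> sum_list (map num_verts ts) = n}"

lemma finite_forests [simp]: "finite (forests i n)"
proof (rule finite_subset)
  show "forests i n \<subseteq> {ts. set ts \<subseteq> {t. num_verts t \<le> n} \<and> length ts = i}"
  proof
    fix ts assume ts: "ts \<in> forests i n"
    then have "num_verts u \<le> n" if "u \<in> set ts" for u
      using member_le_sum_list[of "num_verts u" "map num_verts ts"] that by (auto simp: forests_def)
    with ts show "ts \<in> {ts. set ts \<subseteq> {t. num_verts t \<le> n} \<and> length ts = i}"
      by (auto simp: forests_def)
  qed
qed (rule finite_lists_length_eq[OF finite_num_verts_le])

lemma sum_forests_Suc:
  fixes f :: "ptree list \<Rightarrow> real"
  shows "(\<Sum>ts\<in>forests (Suc i) n. f ts)
    = (\<Sum>m=0..n. \<Sum>t | num_verts t = m. \<Sum>ts\<in>forests i (n - m). f (t # ts))"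
proof -
  have img: "forests (Suc i) n = (\<lambda>(t, ts). t # ts) ` (SIGMA t:{t. num_verts t \<le> n}. forests i (n - num_verts t))"
  proof (intro equalityI subsetI)
    fix us assume "us \<in> forests (Suc i) n"
    then obtain t ts where "us = t # ts" "length ts = i" "num_verts t + sum_list (map num_verts ts) = n"
      by (cases us) (auto simp: forests_def)
    then show "us \<in> (\<lambda>(t, ts). t # ts) ` (SIGMA t:{t. num_verts t \<le> n}. forests i (n - num_verts t))"
      by (auto simp: forests_def intro!: image_eqI[of _ _ "(t, ts)"])
  qed (auto simp: forests_def)
  have "(\<Sum>ts\<in>forests (Suc i) n. f ts)
    = (\<Sum>(t, ts)\<in>(SIGMA t:{t. num_verts t \<le> n}. forests i (n - num_verts t)). f (t # ts))"
    unfolding img by (subst sum.reindex) (auto simp: inj_on_def case_prod_unfold)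
  also have "\<dots> = (\<Sum>t | num_verts t \<le> n. \<Sum>ts\<in>forests i (n - num_verts t). f (t # ts))"
    by (subst sum.Sigma) (auto simp: finite_num_verts_le)
  also have "\<dots> = (\<Sum>m=0..n. \<Sum>t\<in>{t \<in> {t. num_verts t \<le> n}. num_verts t = m}. \<Sum>ts\<in>forests i (n - num_verts t). f (t # ts))"
    by (rule sum.group[symmetric]) (auto simp: finite_num_verts_le)
  also have "\<dots> = (\<Sum>m=0..n. \<Sum>t | num_verts t = m. \<Sum>ts\<in>forests i (n - m). f (t # ts))"
    by (intro sum.cong) auto
  finally show ?thesis .
qed

lemma sum_num_verts_Suc:
  fixes f :: "ptree \<Rightarrow> real"
  shows "(\<Sum>t | num_verts t = Suc n. f t) = (\<Sum>i=0..n. \<Sum>ts\<in>forests i n. f (Node ts))"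
proof -
  have "{t. num_verts t = Suc n} = Node ` (\<Union>i\<in>{0..n}. forests i n)"
  proof (intro equalityI subsetI)
    fix t assume "t \<in> {t. num_verts t = Suc n}"
    moreover obtain ts where t: "t = Node ts" by (cases t)
    ultimately have "ts \<in> forests (length ts) n" by (simp add: forests_def)
    moreover from this have "length ts \<le> n"
      using length_le_sum_num_verts[of ts] by (simp add: forests_def)
    ultimately show "t \<in> Node ` (\<Union>i\<in>{0..n}. forests i n)"
      unfolding t by (intro imageI UN_I[of "length ts"]) auto
  qed (auto simp: forests_def)
  then have "(\<Sum>t | num_verts t = Suc n. f t) = (\<Sum>ts\<in>(\<Union>i\<in>{0..n}. forests i n). f (Node ts))"
    by (simp add: sum.reindex inj_on_def)
  also have "\<dots> = (\<Sum>i=0..n. \<Sum>ts\<in>forests i n. f (Node ts))"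
    by (rule sum.UNION_disjoint) (auto simp: forests_def finite_forests[unfolded forests_def])
  finally show ?thesis .
qed

text \<open>Coefficient \<open>n\<close> is the expectation of \<open>f\<close> on the event of
  having \<open>n\<close> vertices, without conditioning. The choices 1, the indicator of
  \<open>tall\<close>, and \<open>num_tall\<close> give the series A, H and B.\<close>

definition tree_fps :: "(nat \<Rightarrow> real) \<Rightarrow> (ptree \<Rightarrow> real) \<Rightarrow> real fps" where
  "tree_fps p f = Abs_fps (\<lambda>n. \<Sum>t | num_verts t = n. weight p t * f t)"

lemma tree_fps_nth: "tree_fps p f $ n = (\<Sum>t | num_verts t = n. weight p t * f t)"
  by (simp add: tree_fps_def)

lemma tree_fps_nth_0 [simp]: "tree_fps p f $ 0 = 0"
  by (simp add: tree_fps_nth)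

lemma sum_forests_weight:
  "(\<Sum>ts\<in>forests i n. prod_list (map (weight p) ts)) = (tree_fps p (\<lambda>_. 1) ^ i) $ n"
proof (induction i arbitrary: n)
  case 0
  have "forests 0 n = (if n = 0 then {[]} else {})" by (auto simp: forests_def)
  then show ?case by simp
next
  case (Suc i)
  show ?case
    by (simp add: sum_forests_Suc fps_mult_nth tree_fps_nth Suc sum_distrib_left[symmetric]
        sum_distrib_right[symmetric])
qed

text \<open>A product rule: one of the \<open>i\<close> trees is marked and counted by
  \<open>f\<close>, the other i - 1 by weight alone.\<close>

lemma sum_forests_weight_additive:
  "(\<Sum>ts\<in>forests i n. prod_list (map (weight p) ts) * sum_list (map f ts))
    = (of_nat i * tree_fps p (\<lambda>_. 1) ^ (i - 1) * tree_fps p f) $ n"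
proof (induction i arbitrary: n)
  case 0
  have "forests 0 n = (if n = 0 then {[]} else {})" by (auto simp: forests_def)
  then show ?case by simp
next
  case (Suc i)
  let ?A = "tree_fps p (\<lambda>_. 1)"
  have "(\<Sum>ts\<in>forests (Suc i) n. prod_list (map (weight p) ts) * sum_list (map f ts))
     = (\<Sum>m=0..n. \<Sum>t | num_verts t = m. \<Sum>ts\<in>forests i (n - m).
         (weight p t * f t) * prod_list (map (weight p) ts)
         + weight p t * (prod_list (map (weight p) ts) * sum_list (map f ts)))"
    by (simp add: sum_forests_Suc algebra_simps)
  also have "\<dots> = (\<Sum>m=0..n. tree_fps p f $ m * (?A ^ i) $ (n - m)
         + ?A $ m * (of_nat i * ?A ^ (i - 1) * tree_fps p f) $ (n - m))"
    by (simp add: sum.distrib sum_distrib_left[symmetric] sum_distrib_right[symmetric]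
        sum_forests_weight Suc tree_fps_nth)
  also have "\<dots> = (tree_fps p f * ?A ^ i + ?A * (of_nat i * ?A ^ (i - 1) * tree_fps p f)) $ n"
    by (simp add: fps_mult_nth sum.distrib)
  also have "tree_fps p f * ?A ^ i + ?A * (of_nat i * ?A ^ (i - 1) * tree_fps p f)
      = of_nat (Suc i) * ?A ^ (Suc i - 1) * tree_fps p f"
    by (cases i) (simp_all add: algebra_simps)
  finally show ?case .
qed

lemma tree_fps_1_eq:
  "tree_fps p (\<lambda>_. 1) = fps_X * (Abs_fps p oo tree_fps p (\<lambda>_. 1))" (is "?A = _")
proof (rule fps_ext)
  fix n show "?A $ n = (fps_X * (Abs_fps p oo ?A)) $ n"
  proof (cases n)
    case (Suc m)
    have "?A $ Suc m = (\<Sum>i=0..m. \<Sum>ts\<in>forests i m. p i * prod_list (map (weight p) ts))"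
      by (simp add: tree_fps_nth sum_num_verts_Suc) (intro sum.cong, auto simp: forests_def)
    also have "\<dots> = (\<Sum>i=0..m. p i * (?A ^ i) $ m)"
      by (simp add: sum_distrib_left[symmetric] sum_forests_weight)
    finally show ?thesis using Suc by (simp add: fps_compose_nth)
  qed simp
qed

lemma real_sum_list: "real (sum_list (map f xs)) = sum_list (map (\<lambda>x. real (f x)) xs)"
  by (induction xs) simp_all

text \<open>The root contributes H; the other vertices are counted additively over its subtrees,
  where the weights i p_i A^(i-1) sum to F'(A).\<close>

lemma tree_fps_num_tall_eq:
  "tree_fps p (\<lambda>t. num_tall k t) = tree_fps p (\<lambda>t. of_bool (tall k t))
     + fps_X * ((fps_deriv (Abs_fps p) oo tree_fps p (\<lambda>_. 1)) * tree_fps p (\<lambda>t. num_tall k t))"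
  (is "?B = ?H + fps_X * ((?D oo ?A) * ?B)")
proof (rule fps_ext)
  fix n show "?B $ n = (?H + fps_X * ((?D oo ?A) * ?B)) $ n"
  proof (cases n)
    case (Suc m)
    have "?B $ Suc m = ?H $ Suc m
      + (\<Sum>i=0..m. \<Sum>ts\<in>forests i m. p i * (prod_list (map (weight p) ts) * sum_list (map (\<lambda>t. real (num_tall k t)) ts)))"
      unfolding tree_fps_nth sum_num_verts_Suc sum.distrib[symmetric]
      by (intro sum.cong refl) (auto simp: forests_def real_sum_list algebra_simps)
    also have "(\<Sum>i=0..m. \<Sum>ts\<in>forests i m. p i * (prod_list (map (weight p) ts) * sum_list (map (\<lambda>t. real (num_tall k t)) ts)))
      = (\<Sum>i=0..m. p i * (of_nat i * ?A ^ (i - 1) * ?B) $ m)"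
      by (simp add: sum_distrib_left[symmetric] sum_forests_weight_additive)
    \<comment> \<open>The added term vanishes, since A^m B starts at degree m + 1; it makes the
      index shift to F' exact.\<close>
    also have "\<dots> = (\<Sum>i=0..Suc m. p i * (of_nat i * ?A ^ (i - 1) * ?B) $ m)"
    proof -
      have "(?A ^ m * ?B) $ m = 0"
        unfolding fps_mult_nth
      proof (intro sum.neutral ballI)
        fix i assume "i \<in> {0..m}"
        then show "(?A ^ m) $ i * ?B $ (m - i) = 0"
          using startsby_zero_power_prefix[of ?A m] by (cases "i = m") auto
      qed
      then show ?thesis
        by (simp add: fps_mult_of_nat_nth mult.assoc del: of_nat_Suc)
    qed
    also have "\<dots> = (\<Sum>i=0..m. p (Suc i) * (of_nat (Suc i) * ?A ^ i * ?B) $ m)"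
      by (subst sum.atLeast0_atMost_Suc_shift) simp
    also have "\<dots> = (\<Sum>i=0..m. ?D $ i * (?A ^ i * ?B) $ m)"
      by (intro sum.cong refl) (simp add: fps_mult_of_nat_nth mult.assoc mult_ac del: of_nat_Suc)
    also have "\<dots> = ((?D oo ?A) * ?B) $ m"
      by (subst fps_compose_mult_nth) auto
    finally show ?thesis using Suc by simp
  qed simp
qed

lemma weight_nonneg: "(\<And>i. p i \<ge> 0) \<Longrightarrow> weight p t \<ge> 0"
  by (induction t) (auto intro!: mult_nonneg_nonneg prod_list_nonneg)

lemma tree_fps_nonneg: "(\<And>i. p i \<ge> 0) \<Longrightarrow> (\<And>t. f t \<ge> 0) \<Longrightarrow> tree_fps p f $ n \<ge> 0"
  unfolding tree_fps_nth by (intro sum_nonneg mult_nonneg_nonneg weight_nonneg) auto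

section \<open>Tools for the survival recursion\<close>

lemma sum_lists_prod_list:
  fixes w :: "'a \<Rightarrow> real"
  shows "(\<Sum>ts | set ts \<subseteq> S \<and> length ts = i. prod_list (map w ts)) = (\<Sum>t\<in>S. w t) ^ i"
proof (induction i)
  case 0
  have "{ts. set ts \<subseteq> S \<and> length ts = 0} = {[]}" by auto
  then show ?case by simp
next
  case (Suc i)
  have "(\<Sum>ts | set ts \<subseteq> S \<and> length ts = Suc i. prod_list (map w ts))
    = (\<Sum>(ts, t)\<in>{ts. set ts \<subseteq> S \<and> length ts = i} \<times> S. w t * prod_list (map w ts))"
    unfolding lists_length_Suc_eq
    by (subst sum.reindex) (auto simp: inj_on_def case_prod_unfold)
  also have "\<dots> = (\<Sum>t\<in>S. w t) ^ Suc i"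
    by (simp add: sum.cartesian_product[symmetric] sum_distrib_left[symmetric]
        sum_distrib_right[symmetric] Suc)
  finally show ?case .
qed

text \<open>For a fixed difference d of the bases, the difference of powers is largest at 1 and 1 -
  d. This covers sums over small trees only, whose total mass \<alpha> may be below 1.\<close>

lemma power_diff_le:
  fixes \<alpha> \<beta> q :: real
  assumes "0 \<le> \<beta>" "\<beta> \<le> \<alpha>" "\<alpha> \<le> 1" "\<alpha> - \<beta> \<le> q" "q \<le> 1"
  shows "\<alpha> ^ i - \<beta> ^ i \<le> 1 - (1 - q) ^ i"
proof -
  define d where "d = \<alpha> - \<beta>"
  have d: "0 \<le> d" "d \<le> 1" "\<beta> \<le> 1 - d" "d \<le> q" using assms by (auto simp: d_def)
  have "\<alpha> ^ i - \<beta> ^ i = d * (\<Sum>j<i. \<beta> ^ (i - Suc j) * \<alpha> ^ j)"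
    by (simp add: d_def power_diff_sumr2)
  also have "\<dots> \<le> d * (\<Sum>j<i. (1 - d) ^ (i - Suc j) * 1 ^ j)"
    using d assms by (intro mult_left_mono sum_mono mult_mono power_mono) auto
  also have "\<dots> = 1 ^ i - (1 - d) ^ i"
    by (subst power_diff_sumr2) simp
  also have "\<dots> \<le> 1 - (1 - q) ^ i"
    using power_mono[of "1 - q" "1 - d" i] d assms by simp
  finally show ?thesis .
qed

text \<open>The gain q^2 over Bernoulli's inequality is what makes the survival probabilities
  decay.\<close>

lemma one_minus_power_ge:
  fixes q :: real
  assumes "0 \<le> q" "q \<le> 1" "2 \<le> i"
  shows "(1 - q) ^ i \<ge> 1 - real i * q + q\<^sup>2"
  using assms(3)
proof (induction i rule: nat_induct_at_least)
  case base
  show ?case by (simp add: power2_eq_square algebra_simps)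
next
  case (Suc i)
  have "1 - real (Suc i) * q + q\<^sup>2 + q\<^sup>2 * (real i - q) = (1 - q) * (1 - real i * q + q\<^sup>2)"
    by (simp add: algebra_simps power2_eq_square)
  also have "\<dots> \<le> (1 - q) * (1 - q) ^ i"
    using assms Suc.IH by (intro mult_left_mono) auto
  finally have "1 - real (Suc i) * q + q\<^sup>2 + q\<^sup>2 * (real i - q) \<le> (1 - q) ^ Suc i" by simp
  moreover have "q\<^sup>2 * (real i - q) \<ge> 0" using assms(2) Suc.hyps by (intro mult_nonneg_nonneg) auto
  ultimately show ?case by linarith
qed

lemma sum_inverse_sqrt_le: "(\<Sum>m=1..n. 1 / sqrt (real m)) \<le> 2 * sqrt (real n)"
proof (induction n)
  case (Suc n)
  define a b where "a = sqrt n" and "b = sqrt (Suc n)"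
  have ab: "0 \<le> a" "a \<le> b" "0 < b" "b\<^sup>2 = a\<^sup>2 + 1" by (auto simp: a_def b_def)
  have "1 = (b - a) * (b + a)" using ab(4) by (simp add: algebra_simps power2_eq_square)
  also have "\<dots> \<le> (b - a) * (2 * b)" using ab by (intro mult_left_mono) auto
  finally have "1 / b \<le> 2 * (b - a)" using ab(3) by (simp add: field_simps)
  with Suc show ?case by (simp add: a_def b_def)
qed simp

section \<open>Vertices with tall subtrees in critical trees\<close>

context critical_offspring
begin

section \<open>Kolmogorov's survival estimate\<close>

lemma sum_mean_le_1: "finite I \<Longrightarrow> (\<Sum>i\<in>I. real i * p i) \<le> 1"
  using sum_le_suminf[of "\<lambda>i. real i * p i" I] p_mean p_nonneg by (simp add: sums_iff)

lemma sum_p_le_1: "finite I \<Longrightarrow> (\<Sum>i\<in>I. p i) \<le> 1"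
  using sum_le_suminf[of p I] p_sums p_nonneg by (simp add: sums_iff)

text \<open>Bounding the number of vertices keeps all sums finite. Bounding each child subtree
  separately by \<open>m\<close> loses equality but turns the sums over child lists into
  powers.\<close>

lemma sum_weight_Suc_le:
  assumes "\<And>ts. P (Node ts) \<Longrightarrow> length ts \<le> m \<Longrightarrow> set ts \<subseteq> {t. num_verts t \<le> m} \<Longrightarrow> Q ts"
  shows "(\<Sum>t | num_verts t \<le> Suc m \<and> P t. weight p t)
    \<le> (\<Sum>i\<le>m. p i * (\<Sum>ts | set ts \<subseteq> {t. num_verts t \<le> m} \<and> length ts = i \<and> Q ts. prod_list (map (weight p) ts)))"
proof -
  let ?L = "\<lambda>i. {ts. set ts \<subseteq> {t. num_verts t \<le> m} \<and> length ts = i \<and> Q ts}"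
  have fin: "finite (?L i)" for i
    by (rule finite_subset[OF _ finite_lists_length_eq[OF finite_num_verts_le[of m], of i]]) auto
  have "{t. num_verts t \<le> Suc m \<and> P t} \<subseteq> Node ` (\<Union>i\<in>{..m}. ?L i)"
  proof
    fix t assume t: "t \<in> {t. num_verts t \<le> Suc m \<and> P t}"
    obtain ts where ts: "t = Node ts" by (cases t)
    then have le: "sum_list (map num_verts ts) \<le> m" using t by simp
    have "num_verts u \<le> m" if "u \<in> set ts" for u
      using member_le_sum_list[of "num_verts u" "map num_verts ts"] that le by auto
    moreover have "length ts \<le> m" using length_le_sum_num_verts[of ts] le by simp
    ultimately show "t \<in> Node ` (\<Union>i\<in>{..m}. ?L i)"
      using assms[of ts] t ts by (intro image_eqI[of _ _ ts]) auto
  qed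
  then have "(\<Sum>t | num_verts t \<le> Suc m \<and> P t. weight p t) \<le> (\<Sum>t\<in>Node ` (\<Union>i\<in>{..m}. ?L i). weight p t)"
    using fin by (intro sum_mono2) (auto intro: weight_nonneg p_nonneg)
  also have "\<dots> = (\<Sum>ts\<in>(\<Union>i\<in>{..m}. ?L i). weight p (Node ts))"
    by (subst sum.reindex) (auto simp: inj_on_def)
  also have "\<dots> = (\<Sum>i\<le>m. \<Sum>ts\<in>?L i. weight p (Node ts))"
    using fin by (intro sum.UNION_disjoint) auto
  also have "\<dots> = (\<Sum>i\<le>m. p i * (\<Sum>ts\<in>?L i. prod_list (map (weight p) ts)))"
    unfolding sum_distrib_left by (intro sum.cong refl) auto
  finally show ?thesis .
qed

lemma sum_weight_le_1: "(\<Sum>t | num_verts t \<le> m. weight p t) \<le> 1"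
proof (induction m)
  case (Suc m)
  have "(\<Sum>t | num_verts t \<le> Suc m. weight p t)
     \<le> (\<Sum>i\<le>m. p i * (\<Sum>ts | set ts \<subseteq> {t. num_verts t \<le> m} \<and> length ts = i. prod_list (map (weight p) ts)))"
    using sum_weight_Suc_le[of "\<lambda>_. True" m "\<lambda>_. True"] by simp
  also have "\<dots> = (\<Sum>i\<le>m. p i * (\<Sum>t | num_verts t \<le> m. weight p t) ^ i)"
    by (simp add: sum_lists_prod_list)
  also have "\<dots> \<le> (\<Sum>i\<le>m. p i * 1)"
    by (intro sum_mono mult_left_mono power_le_one Suc.IH p_nonneg sum_nonneg weight_nonneg)
  also have "\<dots> \<le> 1" using sum_p_le_1[of "{..m}"] by simp
  finally show ?case .
qed simp

text \<open>
  The survival probabilities satisfy \<open>q\<^bsub>k+1\<^esub> = 1 - F(1 - q\<^sub>k)\<close>, and criticality gives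
  \<open>1 - F(1 - q) \<le> q - p\<^sub>g q\<^sup>2\<close>.
\<close>

fun tail_bound :: "nat \<Rightarrow> real" where
  "tail_bound 0 = 1"
| "tail_bound (Suc k) = tail_bound k - p g * (tail_bound k)\<^sup>2"

lemma p_g_le: "p g \<le> 1 / 2"
proof -
  have "2 * p g \<le> real g * p g" using g_ge p_nonneg by (intro mult_right_mono) auto
  also have "\<dots> \<le> 1" using sum_mean_le_1[of "{g}"] by simp
  finally show ?thesis by simp
qed

lemma denominator_pos: "p g * real k + 1 > 0"
  using p_g by (intro add_nonneg_pos) auto

text \<open>As p_g \<le> 1/2, the map x - p_g x^2 is increasing on [0, 1], so the bound 1/s may be
  inserted; then (s - p_g)(s + p_g) \<le> s^2.\<close>

lemma tail_bound_bounds: "0 \<le> tail_bound k \<and> tail_bound k \<le> 1 / (p g * k + 1)"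
proof (induction k)
  case (Suc k)
  define q s where "q = tail_bound k" and "s = p g * k + 1"
  have s: "s \<ge> 1" "s > 0" using p_g denominator_pos[of k] by (auto simp: s_def)
  have q: "0 \<le> q" "q \<le> 1 / s" using Suc by (auto simp: q_def s_def)
  have "1 / s \<le> 1" using s by simp
  then have q1: "q \<le> 1" using q by linarith
  have "p g * q \<le> 1 * 1" using p_g_le q q1 by (intro mult_mono) auto
  then have "q * (1 - p g * q) \<ge> 0" using q by (intro mult_nonneg_nonneg) auto
  moreover have "q - p g * q\<^sup>2 = q * (1 - p g * q)" by (simp add: algebra_simps power2_eq_square)
  ultimately have nn: "q - p g * q\<^sup>2 \<ge> 0" by simp
  have "(1 / s - q) * (1 - p g * (1 / s + q)) \<ge> 0"
  proof (rule mult_nonneg_nonneg)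
    have "1 / s + q \<le> 1 + 1" using q1 \<open>1 / s \<le> 1\<close> by linarith
    moreover have "0 \<le> 1 / s + q" using q s by simp
    ultimately have "p g * (1 / s + q) \<le> 1 / 2 * (1 + 1)"
      using p_g_le by (intro mult_mono) auto
    then show "1 - p g * (1 / s + q) \<ge> 0" by simp
  qed (use q in simp)
  moreover have "(1 / s - q) * (1 - p g * (1 / s + q)) = (1 / s - p g * (1 / s)\<^sup>2) - (q - p g * q\<^sup>2)"
    by (simp add: algebra_simps power2_eq_square)
  ultimately have "q - p g * q\<^sup>2 \<le> 1 / s - p g * (1 / s)\<^sup>2" by linarith
  also have "\<dots> = (s - p g) / s\<^sup>2" using s by (simp add: field_simps power2_eq_square)
  also have "\<dots> \<le> 1 / (s + p g)"
  proof -
    have "(s - p g) * (s + p g) \<le> s\<^sup>2" by (simp add: algebra_simps power2_eq_square)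
    then show ?thesis using s p_g by (simp add: pos_divide_le_eq pos_le_divide_eq)
  qed
  also have "s + p g = p g * real (Suc k) + 1" by (simp add: s_def algebra_simps)
  finally show ?case using nn by (simp add: q_def)
qed simp

lemma sum_p_one_minus_power_le:
  assumes "0 \<le> q" "q \<le> 1"
  shows "(\<Sum>i\<le>m. p i * (1 - (1 - q) ^ i)) \<le> q - p g * q\<^sup>2"
proof -
  \<comment> \<open>The range is enlarged to contain \<open>g\<close>, the one index at which the
    improved Bernoulli inequality is applied.\<close>
  have "(\<Sum>i\<le>m. p i * (1 - (1 - q) ^ i)) \<le> (\<Sum>i\<le>max m g. p i * (1 - (1 - q) ^ i))"
    using assms by (intro sum_mono2) (auto intro!: mult_nonneg_nonneg p_nonneg power_le_one)
  also have "\<dots> \<le> (\<Sum>i\<le>max m g. q * (real i * p i) - (if i = g then p g * q\<^sup>2 else 0))"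
  proof (intro sum_mono)
    fix i
    show "p i * (1 - (1 - q) ^ i) \<le> q * (real i * p i) - (if i = g then p g * q\<^sup>2 else 0)"
    proof (cases "i = g")
      case True
      have "p g * (1 - (1 - q) ^ g) \<le> p g * (real g * q - q\<^sup>2)"
        using one_minus_power_ge[OF assms g_ge] by (intro mult_left_mono p_nonneg) simp
      then show ?thesis using True by (simp add: algebra_simps)
    next
      case False
      have "p i * (1 - (1 - q) ^ i) \<le> p i * (real i * q)"
        using Bernoulli_inequality[of "- q" i] assms by (intro mult_left_mono p_nonneg) simp
      then show ?thesis using False by (simp add: algebra_simps)
    qed
  qed
  also have "\<dots> = q * (\<Sum>i\<le>max m g. real i * p i) - p g * q\<^sup>2"
    by (simp add: sum_subtractf sum_distrib_left)
  also have "\<dots> \<le> q * 1 - p g * q\<^sup>2"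
    using assms by (intro diff_right_mono mult_left_mono sum_mean_le_1) auto
  finally show ?thesis by simp
qed

text \<open>A tree reaches height k + 1 iff some child subtree reaches height k. Lists of
  \<open>i\<close> subtrees with this property have mass \<alpha>^i - \<beta>^i, all lists minus
  those without a tall member.\<close>

lemma sum_weight_tall_le_tail_bound: "(\<Sum>t | num_verts t \<le> m \<and> tall k t. weight p t) \<le> tail_bound k"
proof (induction k arbitrary: m)
  case 0
  show ?case using sum_weight_le_1[of m] by simp
next
  case (Suc k)
  have q: "0 \<le> tail_bound k" "tail_bound k \<le> 1"
  proof -
    show "0 \<le> tail_bound k" using tail_bound_bounds by blast
    have "1 / (p g * k + 1) \<le> 1" using denominator_pos[of k] p_g by (simp add: pos_divide_le_eq)
    then show "tail_bound k \<le> 1" using tail_bound_bounds[of k] by linarith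
  qed
  show ?case
  proof (cases m)
    case 0
    have "0 \<le> tail_bound (Suc k)" using tail_bound_bounds by blast
    then show ?thesis using 0 by simp
  next
    case (Suc m')
    let ?S = "{t. num_verts t \<le> m'}" and ?R = "{t. num_verts t \<le> m' \<and> \<not> tall k t}"
    have finS: "finite ?S" by (rule finite_num_verts_le)
    have fin: "finite ?R" "finite {t. num_verts t \<le> m' \<and> tall k t}"
      by (rule finite_subset[OF Collect_mono finS], simp)+
    have finL: "finite {ts. set ts \<subseteq> ?S \<and> length ts = i}" for i
      by (rule finite_lists_length_eq[OF finS])
    define \<alpha> \<beta> where "\<alpha> = (\<Sum>t\<in>?S. weight p t)" and "\<beta> = (\<Sum>t\<in>?R. weight p t)"
    have "\<alpha> = (\<Sum>t\<in>?R \<union> {t. num_verts t \<le> m' \<and> tall k t}. weight p t)"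
      unfolding \<alpha>_def by (rule sum.cong) auto
    also have "\<dots> = \<beta> + (\<Sum>t | num_verts t \<le> m' \<and> tall k t. weight p t)"
      unfolding \<beta>_def
      using fin by (intro sum.union_disjoint) auto
    finally have "\<alpha> - \<beta> \<le> tail_bound k" "\<beta> \<le> \<alpha>"
      using Suc.IH[of m'] by (auto intro!: sum_nonneg weight_nonneg p_nonneg)
    moreover have "0 \<le> \<beta>" unfolding \<beta>_def by (intro sum_nonneg weight_nonneg p_nonneg)
    moreover have "\<alpha> \<le> 1" unfolding \<alpha>_def by (rule sum_weight_le_1)
    ultimately have diff: "\<alpha> ^ i - \<beta> ^ i \<le> 1 - (1 - tail_bound k) ^ i" for i
      using q(2) by (intro power_diff_le)
    have L: "(\<Sum>ts | set ts \<subseteq> ?S \<and> length ts = i \<and> (\<exists>t\<in>set ts. tall k t). prod_list (map (weight p) ts))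
       = \<alpha> ^ i - \<beta> ^ i" for i
    proof -
      have "{ts. set ts \<subseteq> ?S \<and> length ts = i \<and> (\<exists>t\<in>set ts. tall k t)}
        = {ts. set ts \<subseteq> ?S \<and> length ts = i} - {ts. set ts \<subseteq> ?R \<and> length ts = i}"
        by auto
      moreover have "{ts. set ts \<subseteq> ?R \<and> length ts = i} \<subseteq> {ts. set ts \<subseteq> ?S \<and> length ts = i}"
        by auto
      ultimately show ?thesis
        unfolding \<alpha>_def \<beta>_def sum_lists_prod_list[symmetric] using finL
        by (simp add: sum_diff)
    qed
    have "(\<Sum>t | num_verts t \<le> Suc m' \<and> tall (Suc k) t. weight p t) \<le> (\<Sum>i\<le>m'. p i * (\<alpha> ^ i - \<beta> ^ i))"
      unfolding L[symmetric] by (rule sum_weight_Suc_le) simp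
    also have "\<dots> \<le> (\<Sum>i\<le>m'. p i * (1 - (1 - tail_bound k) ^ i))"
      by (intro sum_mono mult_left_mono diff p_nonneg)
    also have "\<dots> \<le> tail_bound (Suc k)"
      using sum_p_one_minus_power_le[OF q] by simp
    finally show ?thesis using Suc by simp
  qed
qed

lemma sum_weight_tall_le:
  assumes "k \<ge> 1"
  shows "(\<Sum>t | num_verts t \<le> m \<and> tall k t. weight p t) \<le> 1 / (p g * k)"
proof -
  have "1 / (p g * k + 1) \<le> 1 / (p g * k)"
    using p_g assms denominator_pos[of k] by (intro divide_left_mono mult_pos_pos) auto
  then show ?thesis
    using sum_weight_tall_le_tail_bound[of m k] tail_bound_bounds[of k] by linarith
qed

section \<open>The mean number of vertices with tall subtrees\<close>

definition size_fps :: "real fps" where "size_fps = tree_fps p (\<lambda>_. 1)"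

lemma size_fps_eq: "size_fps = fps_X * (gf oo size_fps)"
  unfolding size_fps_def gf_def by (rule tree_fps_1_eq)

lemma size_fps_nonneg: "size_fps $ n \<ge> 0"
  unfolding size_fps_def by (intro tree_fps_nonneg p_nonneg) simp

lemma size_fps_nth: "real n * size_fps $ n = (gf ^ n) $ (n - 1)" if "n \<ge> 1"
  using otter_dwass[OF size_fps_eq, of 1 n] that by simp

lemma fps_deriv_size_fps_nth: "fps_deriv size_fps $ n = (gf ^ Suc n) $ n"
  using size_fps_nth[of "Suc n"] by simp

text \<open>With D = X F'(A), the root decomposition reads B (1 - D) = H, and differentiating A = X
  F(A) gives A' (1 - D) = F(A). Multiplying crosswise needs no inverse of 1 - D.\<close>

lemma num_tall_identity:
  "tree_fps p (\<lambda>t. real (num_tall k t)) * (gf oo size_fps)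
    = tree_fps p (\<lambda>t. of_bool (tall k t)) * fps_deriv size_fps" (is "?B * _ = ?H * _")
proof -
  define D where "D = fps_X * (fps_deriv gf oo size_fps)"
  have B: "?B * (1 - D) = ?H"
    using tree_fps_num_tall_eq[of p k]
    by (simp add: D_def gf_def[symmetric] size_fps_def[symmetric] algebra_simps)
  have "size_fps $ 0 = 0" by (simp add: size_fps_def)
  from fps_compose_deriv[OF this, of gf]
  have "fps_deriv (gf oo size_fps) = (fps_deriv gf oo size_fps) * fps_deriv size_fps" .
  then have "fps_deriv size_fps = (gf oo size_fps) + D * fps_deriv size_fps"
    using arg_cong[OF size_fps_eq, of fps_deriv] by (simp add: D_def mult.assoc add.commute)
  then have "gf oo size_fps = (1 - D) * fps_deriv size_fps" by (simp add: algebra_simps)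
  then show ?thesis using B by (metis mult.assoc)
qed

text \<open>The convolution of H and A' is split at i = n/2. For small i the factor from A' is O(1 /
  sqrt n) and H has mass O(1 / k). For large i, H_i \<le> A_i = O(n^(-3/2)), while the coefficients
  of A' sum to O(sqrt n); the resulting O(1 / n) is absorbed because k \<le> sqrt n.\<close>

lemma num_tall_fps_le:
  assumes "n \<ge> 1" "k \<ge> 1" "k\<^sup>2 \<le> n"
  shows "tree_fps p (\<lambda>t. real (num_tall k t)) $ n
    \<le> (2 / (sqrt \<theta> * p g) + 8 / \<theta>) / p 0 / (sqrt n * k)"
proof -
  let ?B = "tree_fps p (\<lambda>t. real (num_tall k t))" and ?H = "tree_fps p (\<lambda>t. of_bool (tall k t))"
  define b where "b = (\<lambda>m. (gf ^ m) $ (m - 1))"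
  define Z where "Z = 1 / sqrt \<theta>"
  have Z: "Z > 0" using \<theta>_pos by (simp add: Z_def)
  have n0: "sqrt n > 0" "real n > 0" using assms by auto
  have b_le: "b m \<le> Z / sqrt m" if "m \<ge> 1" for m
  proof -
    have "b m \<le> 1 / sqrt (\<theta> * (m + 1))" unfolding b_def by (rule gf_power_le)
    also have "\<dots> \<le> 1 / sqrt (\<theta> * m)"
      using \<theta>_pos that by (intro divide_left_mono) auto
    finally show ?thesis by (simp add: Z_def real_sqrt_mult)
  qed
  have b0: "b m \<ge> 0" for m unfolding b_def by (rule gf_power_nonneg)
  have H0: "?H $ m \<ge> 0" for m by (intro tree_fps_nonneg p_nonneg) simp
  have H_le: "?H $ m \<le> Z / (m * sqrt m)" if "m \<ge> 1" for m
  proof -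
    have "?H $ m \<le> size_fps $ m"
      unfolding tree_fps_nth size_fps_def by (intro sum_mono mult_left_mono weight_nonneg p_nonneg) simp
    also have "\<dots> = b m / m" using size_fps_nth[OF that] that by (simp add: b_def field_simps)
    also have "\<dots> \<le> Z / sqrt m / m" by (intro divide_right_mono b_le that) simp
    finally show ?thesis by (simp add: mult.commute)
  qed
  \<comment> \<open>\<open>x\<close> bounds \<open>b (n - i + 1)\<close> for 2i \<le> n, and
    \<open>y\<close> bounds the coefficient of \<open>?H\<close> for 2i > n.\<close>
  define x y where "x = 2 * Z / sqrt n" and "y = 4 * Z / (n * sqrt n)"
  have xy: "x \<ge> 0" "y \<ge> 0" using Z by (auto simp: x_def y_def)
  have split: "?H $ i * b (n - i + 1) \<le> ?H $ i * x + y * b (n - i + 1)" if i: "1 \<le> i" "i \<le> n" for i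
  proof (cases "2 * i \<le> n")
    case True
    have "sqrt n / 2 \<le> sqrt (n - i + 1)"
    proof -
      have "n \<le> 4 * (n - i + 1)" using True by presburger
      then have "sqrt n \<le> sqrt (real (4 * (n - i + 1)))" by (intro real_sqrt_le_mono of_nat_mono)
      also have "\<dots> = 2 * sqrt (real (n - i + 1))" by (simp only: of_nat_mult real_sqrt_mult of_nat_numeral real_sqrt_four)
      finally show ?thesis by linarith
    qed
    then have "Z / sqrt (n - i + 1) \<le> Z / (sqrt n / 2)"
      using Z n0 by (intro divide_left_mono) auto
    then have "b (n - i + 1) \<le> x" using b_le[of "n - i + 1"] by (simp add: x_def mult.commute)
    then have "?H $ i * b (n - i + 1) \<le> ?H $ i * x" by (intro mult_left_mono H0)
    then show ?thesis using mult_nonneg_nonneg[OF xy(2) b0[of "n - i + 1"]] by linarith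
  next
    case False
    have "real n / 2 \<le> real i" using False by linarith
    moreover have "sqrt n / 2 \<le> sqrt i"
    proof -
      have "n \<le> 4 * i" using False by linarith
      then have "sqrt n \<le> sqrt (real (4 * i))" by (intro real_sqrt_le_mono of_nat_mono)
      also have "\<dots> = 2 * sqrt (real (i))" by (simp only: of_nat_mult real_sqrt_mult of_nat_numeral real_sqrt_four)
      finally show ?thesis by linarith
    qed
    ultimately have "(real n / 2) * (sqrt n / 2) \<le> i * sqrt i" by (intro mult_mono) auto
    then have "Z / (i * sqrt i) \<le> Z / ((real n / 2) * (sqrt n / 2))"
      using Z n0 i by (intro divide_left_mono mult_pos_pos) auto
    then have "?H $ i \<le> y" using H_le[of i] i by (simp add: y_def mult_ac)
    then have "?H $ i * b (n - i + 1) \<le> y * b (n - i + 1)" by (intro mult_right_mono b0)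
    then show ?thesis using mult_nonneg_nonneg[OF H0[of i] xy(1)] by linarith
  qed
  \<comment> \<open>Only the constant term p_0 of F(A) is kept; all other products are
    nonnegative.\<close>
  have "?B $ n * p 0 = ?B $ n * (gf oo size_fps) $ 0" by simp
  also have "\<dots> \<le> (?B * (gf oo size_fps)) $ (n + 0)"
  proof (rule fps_mult_nth_ge)
    show "?B $ i \<ge> 0" for i by (intro tree_fps_nonneg p_nonneg) simp
    show "(gf oo size_fps) $ i \<ge> 0" for i
      unfolding fps_compose_nth
      by (intro sum_nonneg mult_nonneg_nonneg fps_power_nonneg size_fps_nonneg) (simp add: p_nonneg)
  qed
  also have "\<dots> = (\<Sum>i=0..n. ?H $ i * b (n - i + 1))"
    by (simp add: num_tall_identity fps_mult_nth fps_deriv_size_fps_nth b_def del: fps_deriv_nth)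
  also have "\<dots> = (\<Sum>i=1..n. ?H $ i * b (n - i + 1))"
    by (simp add: sum.atLeast_Suc_atMost)
  also have "\<dots> \<le> (\<Sum>i=1..n. ?H $ i * x + y * b (n - i + 1))"
    by (intro sum_mono split) auto
  also have "\<dots> = (\<Sum>i=1..n. ?H $ i) * x + y * (\<Sum>i=1..n. b (n - i + 1))"
    by (simp add: sum.distrib sum_distrib_left sum_distrib_right)
  also have "\<dots> \<le> 1 / (p g * k) * x + y * (Z * (2 * sqrt n))"
  proof (intro add_mono mult_right_mono mult_left_mono xy)
    have "(\<Sum>i=1..n. ?H $ i) = (\<Sum>i=1..n. \<Sum>t\<in>{t \<in> {t. num_verts t \<le> n \<and> tall k t}. num_verts t = i}. weight p t)"
    proof (rule sum.cong[OF refl])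
      fix i assume i: "i \<in> {1..n}"
      have "?H $ i = (\<Sum>t | num_verts t = i. if tall k t then weight p t else 0)"
        unfolding tree_fps_nth by (intro sum.cong) auto
      also have "\<dots> = (\<Sum>t\<in>{t. num_verts t = i} \<inter> {t. tall k t}. weight p t)"
        by (simp add: sum.If_cases)
      also have "{t. num_verts t = i} \<inter> {t. tall k t} = {t \<in> {t. num_verts t \<le> n \<and> tall k t}. num_verts t = i}"
        using i by auto
      finally show "?H $ i = (\<Sum>t\<in>{t \<in> {t. num_verts t \<le> n \<and> tall k t}. num_verts t = i}. weight p t)" .
    qed
    also have "\<dots> = (\<Sum>t | num_verts t \<le> n \<and> tall k t. weight p t)"
      using finite_num_verts_le[of n] num_verts_pos by (intro sum.group) (auto simp: Suc_le_eq)
    finally show "(\<Sum>i=1..n. ?H $ i) \<le> 1 / (p g * k)" using sum_weight_tall_le[OF assms(2)] by simp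
    have "(\<Sum>i=1..n. b (n - i + 1)) = (\<Sum>i=1..n. b i)"
      by (rule sum.reindex_bij_witness[of _ "\<lambda>i. n - i + 1" "\<lambda>i. n - i + 1"]) auto
    also have "\<dots> \<le> (\<Sum>i=1..n. Z * (1 / sqrt i))"
      by (intro sum_mono) (use b_le in simp)
    also have "\<dots> = Z * (\<Sum>i=1..n. 1 / sqrt i)" by (simp only: sum_distrib_left)
    also have "\<dots> \<le> Z * (2 * sqrt n)" using Z by (intro mult_left_mono sum_inverse_sqrt_le) simp
    finally show "(\<Sum>i=1..n. b (n - i + 1)) \<le> Z * (2 * sqrt n)" .
  qed
  also have "1 / (p g * k) * x = 2 / (sqrt \<theta> * p g) / (sqrt n * k)"
    by (simp add: x_def Z_def mult_ac)
  also have "y * (Z * (2 * sqrt n)) = 8 / \<theta> / n"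
    using n0 \<theta>_pos by (simp add: y_def Z_def)
  also have "2 / (sqrt \<theta> * p g) / (sqrt n * k) + 8 / \<theta> / n
    \<le> 2 / (sqrt \<theta> * p g) / (sqrt n * k) + 8 / \<theta> / (sqrt n * k)"
  proof (intro add_left_mono divide_left_mono)
    have "real k \<le> sqrt n"
    proof (rule real_le_rsqrt)
      show "(real k)\<^sup>2 \<le> real n" using of_nat_mono[OF assms(3), where ?'a = real] by simp
    qed
    then have "sqrt n * k \<le> sqrt n * sqrt n" by (intro mult_left_mono) auto
    then show "sqrt n * k \<le> real n" by simp
  qed (use n0 \<theta>_pos assms in auto)
  also have "\<dots> = (2 / (sqrt \<theta> * p g) + 8 / \<theta>) / (sqrt n * k)"
    by (simp only: add_divide_distrib)
  finally have "?B $ n * p 0 \<le> (2 / (sqrt \<theta> * p g) + 8 / \<theta>) / (sqrt n * k)" .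
  then have "?B $ n \<le> (2 / (sqrt \<theta> * p g) + 8 / \<theta>) / (sqrt n * k) / p 0"
    using p_0 by (simp only: pos_le_divide_eq)
  then show ?thesis by (simp add: mult_ac)
qed

text \<open>Dividing by \<open>size_fps $ n\<close>, which is at least c / (n sqrt n) when positive,
  turns the previous estimate into a conditional mean of order n / k.\<close>

lemma num_tall_mean_le:
  obtains D n0 where "D > 0" "n0 \<ge> 1"
    "\<And>n k. n \<ge> n0 \<Longrightarrow> size_fps $ n > 0 \<Longrightarrow> k \<ge> 1 \<Longrightarrow> k\<^sup>2 \<le> n \<Longrightarrow>
       tree_fps p (\<lambda>t. real (num_tall k t)) $ n \<le> D * n / k * size_fps $ n"
proof -
  obtain c n0 where c: "c > 0"
    "\<And>n. n \<ge> n0 \<Longrightarrow> (gf ^ n) $ (n - 1) > 0 \<Longrightarrow> (gf ^ n) $ (n - 1) \<ge> c / sqrt n"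
    using gf_power_ge by metis
  define E where "E = (2 / (sqrt \<theta> * p g) + 8 / \<theta>) / p 0"
  have E: "E > 0" unfolding E_def using \<theta>_pos p_g p_0 by (intro divide_pos_pos add_pos_pos mult_pos_pos) auto
  show ?thesis
  proof
    show "E / c > 0" using E c by simp
    show "max 1 n0 \<ge> 1" by simp
    fix n k :: nat assume n: "n \<ge> max 1 n0" and pos: "size_fps $ n > 0" and k: "k \<ge> 1" "k\<^sup>2 \<le> n"
    have n1: "n \<ge> 1" using n by simp
    have eq: "(gf ^ n) $ (n - 1) = n * size_fps $ n" using size_fps_nth[OF n1] by simp
    have "c / sqrt n \<le> n * size_fps $ n"
      using c(2)[of n] n pos n1 unfolding eq by simp
    then have "E / c / k * (c / sqrt n) \<le> E / c / k * (n * size_fps $ n)"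
      using E c by (intro mult_left_mono) auto
    moreover have "E / c / k * (c / sqrt n) = E / (sqrt n * k)"
      using c(1) by simp
    ultimately have "E / (sqrt n * k) \<le> E / c * n / k * size_fps $ n" by (simp add: mult_ac)
    with num_tall_fps_le[OF n1 k] show "tree_fps p (\<lambda>t. real (num_tall k t)) $ n \<le> E / c * n / k * size_fps $ n"
      unfolding E_def by linarith
  qed
qed

end

section \<open>The law of the Galton--Watson tree\<close>

lemma pmf_nat_sums:
  fixes \<xi> :: "nat pmf" and f :: "nat \<Rightarrow> real"
  assumes "integrable (measure_pmf \<xi>) f"
  shows "(\<lambda>i. f i * pmf \<xi> i) sums measure_pmf.expectation \<xi> f"
proof -
  have "integrable (count_space UNIV) (\<lambda>i. pmf \<xi> i *\<^sub>R f i)"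
    using assms unfolding measure_pmf_eq_density by (subst (asm) integrable_density) auto
  then have "(\<lambda>i. pmf \<xi> i *\<^sub>R f i) sums integral\<^sup>L (count_space UNIV) (\<lambda>i. pmf \<xi> i *\<^sub>R f i)"
    by (rule sums_integral_count_space_nat)
  also have "integral\<^sup>L (count_space UNIV) (\<lambda>i. pmf \<xi> i *\<^sub>R f i) = measure_pmf.expectation \<xi> f"
    unfolding measure_pmf_eq_density by (subst integral_density) auto
  finally show ?thesis by (simp add: mult.commute)
qed

text \<open>Everything follows from the vanishing sum of (i - 1) p_i. Without mass at 0 all its
  terms are nonnegative, forcing the law to sit at 1; without mass above 1 only the term at 0 is
  left.\<close>

lemma critical_offspring_pmf:
  fixes \<xi> :: "nat pmf"
  assumes mean: "measure_pmf.expectation \<xi> real = 1"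
    and second: "integrable (measure_pmf \<xi>) (\<lambda>i. (real i)\<^sup>2)"
    and var: "measure_pmf.variance \<xi> real > 0"
  shows "\<exists>g. critical_offspring (pmf \<xi>) g"
proof -
  let ?p = "pmf \<xi>"
  \<comment> \<open>A non-integrable function has integral 0 by convention, which is not the mean
    1.\<close>
  have int: "integrable (measure_pmf \<xi>) real"
    using mean not_integrable_integral_eq by fastforce
  have 0: "?p sums 1" using pmf_nat_sums[of \<xi> "\<lambda>_. 1"] by simp
  have 1: "(\<lambda>i. real i * ?p i) sums 1" using pmf_nat_sums[OF int] mean by simp
  have 2: "(\<lambda>i. (real i)\<^sup>2 * ?p i) sums measure_pmf.expectation \<xi> (\<lambda>i. (real i)\<^sup>2)"
    by (rule pmf_nat_sums[OF second])
  have nontrivial: "\<exists>i. i \<noteq> 1 \<and> ?p i \<noteq> 0"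
  proof (rule ccontr)
    assume "\<not> ?thesis"
    then have z: "?p i = 0" if "i \<noteq> 1" for i using that by blast
    have "integrable (measure_pmf \<xi>) (\<lambda>i. (real i)\<^sup>2 - 2 * real i + 1)"
      using second int by auto
    moreover have "(real i - 1)\<^sup>2 = (real i)\<^sup>2 - 2 * real i + 1" for i
      by (simp add: power2_eq_square algebra_simps)
    ultimately have "integrable (measure_pmf \<xi>) (\<lambda>i. (real i - 1)\<^sup>2)" by simp
    from pmf_nat_sums[OF this]
    have "(\<lambda>i. (real i - 1)\<^sup>2 * ?p i) sums measure_pmf.variance \<xi> real" by (simp add: mean)
    moreover have "(real i - 1)\<^sup>2 * ?p i = 0" for i by (cases "i = 1") (auto simp: z)
    ultimately have "measure_pmf.variance \<xi> real = 0" by (simp add: sums_iff)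
    with var show False by simp
  qed
  have diff: "(\<lambda>i. (real i - 1) * ?p i) sums 0"
    using sums_diff[OF 1 0] by (simp add: left_diff_distrib)
  have p0: "?p 0 \<noteq> 0"
  proof
    assume p0: "?p 0 = 0"
    have "(real i - 1) * ?p i \<ge> 0" for i by (cases i) (auto simp: p0)
    then have "\<forall>i. (real i - 1) * ?p i = 0"
      using diff suminf_eq_zero_iff[of "\<lambda>i. (real i - 1) * ?p i"] by (simp add: sums_iff)
    with nontrivial show False by auto
  qed
  have "\<exists>g\<ge>2. ?p g \<noteq> 0"
  proof (rule ccontr)
    assume "\<not> ?thesis"
    then have z: "?p i = 0" if "i \<ge> 2" for i using that by blast
    have "(real i - 1) * ?p i = (if i = 0 then - ?p i else 0)" for i
      using z[of i] by (cases "i \<ge> 2") (auto simp: not_le less_2_cases_iff)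
    then have "(\<lambda>i. if i = 0 then - ?p i else 0) sums 0" using diff by simp
    moreover have "(\<lambda>i. if i = 0 then - ?p i else 0) sums (- ?p 0)" by (rule sums_single)
    ultimately have "- ?p 0 = 0" using sums_unique2 by blast
    with p0 show False by simp
  qed
  then obtain g where g: "g \<ge> 2" "?p g \<noteq> 0" by blast
  have "critical_offspring ?p g"
    by standard (use 0 1 2 p0 g in \<open>auto simp: sums_iff pmf_pos\<close>)
  then show ?thesis ..
qed

section \<open>Probabilities as finite sums over plane trees\<close>

lemma gw_tree_eq_verts_iff:
  "gw_tree X \<omega> = verts t \<longleftrightarrow> (\<forall>v\<in>verts t. X v \<omega> = nchildren t v)"
  unfolding gw_tree_def by (rule offspring_tree_eq_verts_iff)

lemma has_size_gw_tree_iff: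
  "has_size (gw_tree X \<omega>) n \<longleftrightarrow> (\<exists>t. num_verts t = n \<and> gw_tree X \<omega> = verts t)"
proof
  assume size: "has_size (gw_tree X \<omega>) n"
  then have "finite (offspring_tree (\<lambda>v. X v \<omega>))" by (simp add: has_size_def gw_tree_def)
  then obtain t where t: "gw_tree X \<omega> = verts t"
    unfolding gw_tree_def using finite_offspring_tree_eq_verts by blast
  with size have "num_verts t = n" by (simp add: has_size_def card_verts)
  with t show "\<exists>t. num_verts t = n \<and> gw_tree X \<omega> = verts t" by blast
next
  assume "\<exists>t. num_verts t = n \<and> gw_tree X \<omega> = verts t"
  then obtain t where "num_verts t = n" "gw_tree X \<omega> = verts t" by blast
  then show "has_size (gw_tree X \<omega>) n" by (simp add: has_size_def card_verts)
qed

context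
  fixes M :: "'w measure" and \<xi> :: "nat pmf" and X :: "nat list \<Rightarrow> 'w \<Rightarrow> nat"
  assumes prob_space: "prob_space M"
    and indep: "prob_space.indep_vars M (\<lambda>_. count_space UNIV) X UNIV"
    and offspring: "\<And>v. distr M (count_space UNIV) (X v) = measure_pmf \<xi>"
begin

interpretation prob_space M by (rule prob_space)

lemma gw_tree_event:
  "{\<omega> \<in> space M. gw_tree X \<omega> = verts t} \<in> sets M"
  "prob {\<omega> \<in> space M. gw_tree X \<omega> = verts t} = weight (pmf \<xi>) t"
proof -
  have meas: "X v \<in> measurable M (count_space UNIV)" for v
    using indep by (auto simp: indep_vars_def)
  have eq: "{\<omega> \<in> space M. gw_tree X \<omega> = verts t} = (\<Inter>v\<in>verts t. X v -` {nchildren t v} \<inter> space M)"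
    unfolding gw_tree_eq_verts_iff using Nil_in_verts[of t] by blast
  have ne: "verts t \<noteq> {}" using Nil_in_verts[of t] by blast
  show "{\<omega> \<in> space M. gw_tree X \<omega> = verts t} \<in> sets M"
    unfolding eq using ne by (intro sets.finite_INT measurable_sets[OF meas]) auto
  have "prob (X v -` {i} \<inter> space M) = pmf \<xi> i" for v i
    using measure_distr[OF meas, of "{i}" v] by (simp add: offspring pmf.rep_eq)
  then show "prob {\<omega> \<in> space M. gw_tree X \<omega> = verts t} = weight (pmf \<xi>) t"
    unfolding eq by (subst indep_varsD[OF indep ne]) (auto simp: prod_nchildren)
qed

text \<open>Only finitely many trees have \<open>n\<close> vertices and their events are disjoint,
  so any predicate \<open>Q\<close> of the tree yields a measurable event here.\<close>

lemma prob_gw_tree_size: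
  "\<P>(\<omega> in M. Q (gw_tree X \<omega>) \<and> has_size (gw_tree X \<omega>) n) = (\<Sum>t | num_verts t = n \<and> Q (verts t). weight (pmf \<xi>) t)"
proof -
  let ?T = "{t. num_verts t = n \<and> Q (verts t)}"
  have fin: "finite ?T" by (rule finite_subset[OF _ finite_num_verts_eq[of n]]) auto
  have "{\<omega> \<in> space M. Q (gw_tree X \<omega>) \<and> has_size (gw_tree X \<omega>) n}
      = (\<Union>t\<in>?T. {\<omega> \<in> space M. gw_tree X \<omega> = verts t})"
    unfolding has_size_gw_tree_iff by (intro set_eqI) (simp, metis)
  moreover have "prob (\<Union>t\<in>?T. {\<omega> \<in> space M. gw_tree X \<omega> = verts t})
      = (\<Sum>t\<in>?T. prob {\<omega> \<in> space M. gw_tree X \<omega> = verts t})"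
    by (rule finite_measure_finite_Union[OF fin])
       (auto simp: gw_tree_event disjoint_family_on_def)
  ultimately show ?thesis by (simp add: gw_tree_event)
qed

lemma one_minus_cond_prob_eq:
  assumes "\<P>(\<omega> in M. has_size (gw_tree X \<omega>) n) > 0"
  shows "1 - \<P>(\<omega> in M. Q (gw_tree X \<omega>) \<bar> has_size (gw_tree X \<omega>) n)
    = (\<Sum>t | num_verts t = n \<and> \<not> Q (verts t). weight (pmf \<xi>) t) / (\<Sum>t | num_verts t = n. weight (pmf \<xi>) t)"
proof -
  have tot: "\<P>(\<omega> in M. has_size (gw_tree X \<omega>) n) = (\<Sum>t | num_verts t = n. weight (pmf \<xi>) t)"
    using prob_gw_tree_size[of "\<lambda>_. True" n] by simp
  let ?good = "{t. num_verts t = n \<and> Q (verts t)}" and ?bad = "{t. num_verts t = n \<and> \<not> Q (verts t)}"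
  have "finite ?good" "finite ?bad"
    by (rule finite_subset[OF Collect_mono finite_num_verts_eq[of n]], simp)+
  then have "(\<Sum>t\<in>?good \<union> ?bad. weight (pmf \<xi>) t) = (\<Sum>t\<in>?good. weight (pmf \<xi>) t) + (\<Sum>t\<in>?bad. weight (pmf \<xi>) t)"
    by (rule sum.union_disjoint) blast
  moreover have "?good \<union> ?bad = {t. num_verts t = n}" by blast
  ultimately have "(\<Sum>t | num_verts t = n. weight (pmf \<xi>) t)
      = (\<Sum>t\<in>?good. weight (pmf \<xi>) t) + (\<Sum>t\<in>?bad. weight (pmf \<xi>) t)"
    by simp
  then show ?thesis
    using assms unfolding cond_prob_def prob_gw_tree_size tot by (simp add: field_simps)
qed

end

section \<open>The cube-root scale and the conclusion by Markov's inequality\<close>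

lemma floor_cube_root_ge:
  fixes x :: real
  assumes "x \<ge> 1"
  defines "k \<equiv> nat \<lfloor>x powr (1 / 3)\<rfloor>"
  shows "k \<ge> 1" and "x \<le> 8 * real k ^ 3"
proof -
  define y where "y = x powr (1 / 3)"
  have y1: "y \<ge> 1" using assms by (simp add: y_def ge_one_powr_ge_zero)
  then show k1: "k \<ge> 1" by (simp add: k_def y_def[symmetric] le_nat_iff)
  \<comment> \<open>A number that is at least 1 is at most twice its floor.\<close>
  have "y \<le> 2 * real k" using y1 k1 unfolding k_def y_def[symmetric] by linarith
  then have "y ^ 3 \<le> (2 * real k) ^ 3" using y1 by (intro power_mono) auto
  moreover have "y ^ 3 = x"
    using assms by (simp add: y_def powr_powr powr_realpow[symmetric])
  ultimately show "x \<le> 8 * real k ^ 3" by (simp add: power_mult_distrib)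
qed

theorem theorem3:
  fixes M :: "'w measure"
    and \<xi> :: "nat pmf"
    and X :: "nat list \<Rightarrow> 'w \<Rightarrow> nat"
    and \<epsilon> :: "nat \<Rightarrow> real"
    and k :: "nat \<Rightarrow> nat"
  assumes mean: "measure_pmf.expectation \<xi> real = 1"
    and finite_variance: "integrable (measure_pmf \<xi>) (\<lambda>i. (real i)\<^sup>2)"
    and pos_variance: "measure_pmf.variance \<xi> real > 0"
    and prob_space: "prob_space M"
    and indep: "prob_space.indep_vars M (\<lambda>_. count_space UNIV) X UNIV"
    and offspring: "\<And>v. distr M (count_space UNIV) (X v) = measure_pmf \<xi>"
    and eps_pos: "\<And>n. \<epsilon> n > 0"
    and eps_lim: "\<epsilon> \<longlonglongrightarrow> 0"
    and k: "\<And>n. k n = nat \<lfloor>(real n / \<epsilon> n) powr (1 / 3)\<rfloor>"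
  shows "(\<lambda>n. 1 - \<P>(\<omega> in M.
              int (Min ((\<lambda>j. card (C_set (k n) j (gw_tree X \<omega>))) ` {0..<k n})) \<le> 2 * int (k n) - 1
              \<bar> has_size (gw_tree X \<omega>) n))
         \<in> O[inf sequentially (principal {n. \<P>(\<omega> in M. has_size (gw_tree X \<omega>) n) > 0})](\<epsilon>)"
proof -
  obtain g where "critical_offspring (pmf \<xi>) g"
    using critical_offspring_pmf[OF mean finite_variance pos_variance] by blast
  then interpret critical_offspring "pmf \<xi>" g .
  obtain D n0 where D: "D > 0" "n0 \<ge> 1"
    "\<And>n k. n \<ge> n0 \<Longrightarrow> size_fps $ n > 0 \<Longrightarrow> k \<ge> 1 \<Longrightarrow> k\<^sup>2 \<le> n \<Longrightarrow>
       tree_fps (pmf \<xi>) (\<lambda>t. real (num_tall k t)) $ n \<le> D * n / k * size_fps $ n"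
    using num_tall_mean_le by metis
  have size: "size_fps $ n = (\<Sum>t | num_verts t = n. weight (pmf \<xi>) t)" for n
    by (simp add: size_fps_def tree_fps_nth)
  \<comment> \<open>Together with n \<ge> 1 this gives n / \<epsilon> \<ge> 1, hence
    \<open>k n\<close> \<ge> 1 and a minimum over a nonempty set.\<close>
  have "\<forall>\<^sub>F n in sequentially. \<epsilon> n < 1"
    using eps_lim by (rule order_tendstoD) simp
  then have "\<forall>\<^sub>F n in sequentially. \<epsilon> n < 1 \<and> n0 \<le> n"
    using eventually_ge_at_top by (rule eventually_conj)
  then have "\<forall>\<^sub>F n in inf sequentially (principal {n. \<P>(\<omega> in M. has_size (gw_tree X \<omega>) n) > 0}).
     norm (1 - \<P>(\<omega> in M.
              int (Min ((\<lambda>j. card (C_set (k n) j (gw_tree X \<omega>))) ` {0..<k n})) \<le> 2 * int (k n) - 1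
              \<bar> has_size (gw_tree X \<omega>) n)) \<le> 4 * D * norm (\<epsilon> n)"
    unfolding eventually_inf_principal
  proof (rule eventually_mono, intro impI)
    fix n assume n: "\<epsilon> n < 1 \<and> n0 \<le> n"
      and "n \<in> {n. \<P>(\<omega> in M. has_size (gw_tree X \<omega>) n) > 0}"
    then have pos: "\<P>(\<omega> in M. has_size (gw_tree X \<omega>) n) > 0" by simp
    define Q where "Q = (\<lambda>T. int (Min ((\<lambda>j. card (C_set (k n) j T)) ` {0..<k n})) \<le> 2 * int (k n) - 1)"
    define bad where "bad = (\<Sum>t | num_verts t = n \<and> \<not> Q (verts t). weight (pmf \<xi>) t)"
    have eq: "1 - \<P>(\<omega> in M. Q (gw_tree X \<omega>) \<bar> has_size (gw_tree X \<omega>) n) = bad / size_fps $ n"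
      unfolding bad_def size by (rule one_minus_cond_prob_eq[OF prob_space indep offspring pos])
    have "\<P>(\<omega> in M. has_size (gw_tree X \<omega>) n) = size_fps $ n"
      using prob_gw_tree_size[OF prob_space indep offspring, of "\<lambda>_. True" n] by (simp add: size)
    then have size_pos: "size_fps $ n > 0" using pos by simp
    have "real n \<ge> 1" using n D(2) by linarith
    then have "real n / \<epsilon> n \<ge> 1" using n eps_pos[of n] by (simp add: pos_le_divide_eq)
    note cube = floor_cube_root_ge[OF this, folded k]
    have bad_tall: "2 * k n * k n \<le> num_tall (k n) t" if "\<not> Q (verts t)" for t
      by (rule Min_C_set_bound) (use that cube(1) in \<open>auto simp: Q_def\<close>)
    have bad_nonneg: "bad \<ge> 0" unfolding bad_def by (intro sum_nonneg weight_nonneg p_nonneg)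
    have "bad \<le> 4 * D * \<epsilon> n * size_fps $ n"
    proof (cases "(k n)\<^sup>2 \<le> n")
      case True
      \<comment> \<open>Markov's inequality: every bad tree has at least 2 k^2 counted vertices.
        This bounds the bad fraction by D n / (2 k^3), and n \<le> 8 \<epsilon> k^3 produces the
        constant 4 D.\<close>
      have "(2 * real (k n) * real (k n)) * bad
          = (\<Sum>t | num_verts t = n \<and> \<not> Q (verts t). weight (pmf \<xi>) t * (2 * real (k n) * real (k n)))"
        by (simp add: bad_def sum_distrib_left mult.commute)
      also have "\<dots> \<le> (\<Sum>t | num_verts t = n \<and> \<not> Q (verts t). weight (pmf \<xi>) t * real (num_tall (k n) t))"
      proof (intro sum_mono mult_left_mono weight_nonneg p_nonneg)
        fix t assume "t \<in> {t. num_verts t = n \<and> \<not> Q (verts t)}"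
        then have "real (2 * k n * k n) \<le> real (num_tall (k n) t)" using bad_tall by (intro of_nat_mono) auto
        then show "2 * real (k n) * real (k n) \<le> real (num_tall (k n) t)" by simp
      qed
      also have "\<dots> \<le> tree_fps (pmf \<xi>) (\<lambda>t. real (num_tall (k n) t)) $ n"
        unfolding tree_fps_nth
        by (rule sum_mono2) (auto intro!: mult_nonneg_nonneg weight_nonneg p_nonneg)
      also have "\<dots> \<le> D * n / k n * size_fps $ n"
        by (rule D(3)) (use n size_pos cube(1) True in auto)
      finally have "2 * real (k n) * real (k n) * bad \<le> D * n / k n * size_fps $ n" .
      then have "2 * real (k n) ^ 3 * bad \<le> D * size_fps $ n * n"
        using cube(1) by (simp add: pos_le_divide_eq power3_eq_cube mult_ac)
      also have "\<dots> \<le> D * size_fps $ n * (\<epsilon> n * (8 * real (k n) ^ 3))"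
        using cube(2) eps_pos[of n] D(1) size_pos
        by (intro mult_left_mono) (auto simp: pos_divide_le_eq mult.commute)
      finally have "(2 * real (k n) ^ 3) * bad \<le> (2 * real (k n) ^ 3) * (4 * D * \<epsilon> n * size_fps $ n)"
        by (simp add: mult_ac)
      then show ?thesis using cube(1) by (subst (asm) mult_le_cancel_left_pos) auto
    next
      case False
      \<comment> \<open>For k^2 > n a bad tree would need more than \<open>n\<close>
        vertices.\<close>
      have "Q (verts t)" if "num_verts t = n" for t
      proof (rule ccontr)
        assume "\<not> Q (verts t)"
        from bad_tall[OF this] num_tall_le_num_verts[of "k n" t] have "2 * (k n)\<^sup>2 \<le> n"
          using that by (simp add: power2_eq_square)
        with False show False by simp
      qed
      then have "{t. num_verts t = n \<and> \<not> Q (verts t)} = {}" by auto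
      then have "bad = 0" by (simp only: bad_def sum.empty)
      then show ?thesis using D(1) eps_pos[of n] size_pos by simp
    qed
    then have "bad / size_fps $ n \<le> 4 * D * \<epsilon> n" using size_pos by (simp add: pos_divide_le_eq)
    moreover have "bad / size_fps $ n \<ge> 0" using bad_nonneg size_pos by simp
    ultimately have "norm (1 - \<P>(\<omega> in M. Q (gw_tree X \<omega>) \<bar> has_size (gw_tree X \<omega>) n)) \<le> 4 * D * norm (\<epsilon> n)"
      unfolding eq using eps_pos[of n] by simp
    then show "norm (1 - \<P>(\<omega> in M.
              int (Min ((\<lambda>j. card (C_set (k n) j (gw_tree X \<omega>))) ` {0..<k n})) \<le> 2 * int (k n) - 1
              \<bar> has_size (gw_tree X \<omega>) n)) \<le> 4 * D * norm (\<epsilon> n)"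
      unfolding Q_def .
  qed
  then show ?thesis by (rule bigoI)
qed

end
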